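(* Let the constant parameters satisfy $4\alpha_0+3\alpha_1+2\alpha_2+\alpha_3+3\alpha_4+2\alpha_5+\alpha_6+2\alpha_7=0$ and consider the system $\frac{dq}{dt}=\frac{\partial I}{\partial p}$, $\frac{dp}{dt}=-\frac{\partial I}{\partial q}$ with the Hamiltonian $I$ given in the context. This system admits extended affine Weyl group symmetry of type $E_7^{(1)}$ as the group of its Bäcklund transformations, whose generators $s_0,\dots,s_7$ and $\pi$ are explicitly given, with the notation $( * )=(q,p,t;\alpha_0,\alpha_1,\dots,\alpha_7)$, by $$\begin{aligned} s_0:( * )&\to\left(q+\tfrac{\alpha_0}{p},p,t;-\alpha_0,\alpha_1+\alpha_0,\alpha_2,\alpha_3,\alpha_4+\alpha_0,\alpha_5,\alpha_6,\alpha_7+\alpha_0\right),\\ s_1:( * )&\to\left(q,p-\tfrac{\alpha_1}{q},t;\alpha_0+\alpha_1,-\alpha_1,\alpha_2+\alpha_1,\alpha_3,\alpha_4,\alpha_5,\alpha_6,\alpha_7\right),\\ s_2:( * )&\to(q,p,t;\alpha_0,\alpha_1+\alpha_2,-\alpha_2,\alpha_3+\alpha_2,\alpha_4,\alpha_5,\alpha_6,\alpha_7),\\ s_3:( * )&\to(q,p,t;\alpha_0,\alpha_1,\alpha_2+\alpha_3,-\alpha_3,\alpha_4,\alpha_5,\alpha_6,\alpha_7),\\ s_4:( * )&\to\left(q,p-\tfrac{\alpha_4}{q-1},t;\alpha_0+\alpha_4,\alpha_1,\alpha_2,\alpha_3,-\alpha_4,\alpha_5+\alpha_4,\alpha_6,\alpha_7\right),\\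 s_5:( * )&\to(q,p,t;\alpha_0,\alpha_1,\alpha_2,\alpha_3,\alpha_4+\alpha_5,-\alpha_5,\alpha_6+\alpha_5,\alpha_7),\\ s_6:( * )&\to(q,p,t;\alpha_0,\alpha_1,\alpha_2,\alpha_3,\alpha_4,\alpha_5+\alpha_6,-\alpha_6,\alpha_7),\\ s_7:( * )&\to(q,p,t;\alpha_0+\alpha_7,\alpha_1,\alpha_2,\alpha_3,\alpha_4,\alpha_5,\alpha_6,-\alpha_7),\\ \pi:( * )&\to(1-q,-p,t+1;\alpha_0,\alpha_4,\alpha_5,\alpha_6,\alpha_1,\alpha_2,\alpha_3,\alpha_7), \end{aligned}$$ where $\pi$ is the Dynkin diagram automorphism of type $E_7^{(1)}$.
   Context: The Hamiltonian is $$\begin{aligned} I={}&q^3(q-1)^3p^4+q^2(q-1)^2(2\kappa q+\beta_1)p^3+q(q-1)\{\delta q^2+(\gamma_2-\beta_2-\delta)q+\beta_2\}p^2\\ &+\{2\kappa\varepsilon q^3+f_2q^2-(2\kappa\varepsilon+f_2+\beta_3+\gamma_3)q+\beta_3\}p+\varepsilon^2q^2+\varepsilon b\,q, \end{aligned}$$ where $\kappa=2\alpha_0+\alpha_7$, $\varepsilon=\alpha_0(\alpha_0+\alpha_7)$, $\delta=\kappa^2+2\varepsilon$; $\beta_1,\beta_2,\beta_3$ are the elementary symmetric functions (of degree 1, 2, 3) of $\alpha_1,\ \alpha_1+\alpha_2,\ \alpha_1+\alpha_2+\alpha_3$; $\gamma_1,\gamma_2,\gamma_3$ are the elementary symmetric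 functions of $\alpha_4,\ \alpha_4+\alpha_5,\ \alpha_4+\alpha_5+\alpha_6$; $f_2=\kappa(\gamma_2-\beta_2)-\kappa^3-2\kappa\varepsilon-\kappa^2\beta_1+\varepsilon\beta_1$, and $b=\gamma_2-\beta_2-\kappa^2-\varepsilon-\kappa\beta_1$. Each listed transformation $w$ sends each entry of $( * )$ to the corresponding entry on the right; e.g. $s_0(\alpha_0)=-\alpha_0$, $s_0(\alpha_1)=\alpha_1+\alpha_0$, $s_0(\alpha_2)=\alpha_2$, $s_0(\alpha_3)=\alpha_3$, $s_0(\alpha_4)=\alpha_4+\alpha_0$, $s_0(\alpha_5)=\alpha_5$, $s_0(\alpha_6)=\alpha_6$, $s_0(\alpha_7)=\alpha_7+\alpha_0$, $s_0(q)=q+\alpha_0/p$, $s_0(p)=p$, $s_0(t)=t$. It is a Bäcklund transformation of the system if, whenever $(q,p)$ satisfies the system, $(w(q),w(p))$ satisfies the same system with time variable $w(t)$ and parameters $w(\alpha_i)$. The Dynkin diagram of type $E_7^{(1)}$ has nodes $0,\dots,7$ and edges $0\!-\!1$, $1\!-\!2$, $2\!-\!3$, $0\!-\!4$, $4\!-\!5$, $5\!-\!6$, $0\!-\!7$. The affine Weyl group $W(E_7^{(1)})$ has generators $s_0,\dots,s_7$ and relations $s_i^2=1$, $(s_is_j)^3=1$ if $i,j$ are joined by an edge, $(s_is_j)^2=1$ if $i\ne j$ are not joined. The extended affine Weyl group $\tilde W(E_7^{(1)})$ is its extension by the diagram automorphism.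
   Formalization: Since π sends t to t+1, π² is the shift t→t+2 and not the identity; so the group generated by s_0,…,s_7 and π is shown to be the extended affine Weyl group only modulo pure time translations (⟨s_0,…,s_7⟩ is W(E_7^(1)) exactly). *)

theory Defs
  imports "HOL-Analysis.Analysis" "HOL-Algebra.Bij" "HOL-Algebra.Coset" "HOL-Algebra.Generated_Groups"
begin

section \<open>The Dynkin diagram\<close>

datatype node = N0 | N1 | N2 | N3 | N4 | N5 | N6 | N7

definition edges :: "(node \<times> node) set" where
  "edges = {(N0,N1), (N1,N2), (N2,N3), (N0,N4), (N4,N5), (N5,N6), (N0,N7)}"

definition adjacent :: "node \<Rightarrow> node \<Rightarrow> bool" where
  "adjacent i j \<longleftrightarrow> (i,j) \<in> edges \<or> (j,i) \<in> edges"

fun diagram_aut :: "node \<Rightarrow> node" where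
  "diagram_aut N0 = N0"
| "diagram_aut N1 = N4"
| "diagram_aut N2 = N5"
| "diagram_aut N3 = N6"
| "diagram_aut N4 = N1"
| "diagram_aut N5 = N2"
| "diagram_aut N6 = N3"
| "diagram_aut N7 = N7"


section \<open>The Hamiltonian system\<close>

type_synonym params = "node \<Rightarrow> complex"

definition admissible :: "params \<Rightarrow> bool" where
  "admissible a \<longleftrightarrow>
     4 * a N0 + 3 * a N1 + 2 * a N2 + a N3 + 3 * a N4 + 2 * a N5 + a N6 + 2 * a N7 = 0"

definition esym1 :: "complex \<Rightarrow> complex \<Rightarrow> complex \<Rightarrow> complex" where
  "esym1 x y z = x + y + z"
definition esym2 :: "complex \<Rightarrow> complex \<Rightarrow> complex \<Rightarrow> complex" where
  "esym2 x y z = x * y + x * z + y * z"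
definition esym3 :: "complex \<Rightarrow> complex \<Rightarrow> complex \<Rightarrow> complex" where
  "esym3 x y z = x * y * z"

definition hamiltonian :: "params \<Rightarrow> complex \<Rightarrow> complex \<Rightarrow> complex" where
  "hamiltonian a q p =
    (let \<kappa> = 2 * a N0 + a N7;
         \<epsilon> = a N0 * (a N0 + a N7);
         \<delta> = \<kappa>^2 + 2 * \<epsilon>;
         \<beta>1 = esym1 (a N1) (a N1 + a N2) (a N1 + a N2 + a N3);
         \<beta>2 = esym2 (a N1) (a N1 + a N2) (a N1 + a N2 + a N3);
         \<beta>3 = esym3 (a N1) (a N1 + a N2) (a N1 + a N2 + a N3);
         \<gamma>2 = esym2 (a N4) (a N4 + a N5) (a N4 + a N5 + a N6);
         \<gamma>3 = esym3 (a N4) (a N4 + a N5) (a N4 + a N5 + a N6);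
         f2 = \<kappa> * (\<gamma>2 - \<beta>2) - \<kappa>^3 - 2 * \<kappa> * \<epsilon> - \<kappa>^2 * \<beta>1 + \<epsilon> * \<beta>1;
         b = \<gamma>2 - \<beta>2 - \<kappa>^2 - \<epsilon> - \<kappa> * \<beta>1
     in q^3 * (q - 1)^3 * p^4
        + q^2 * (q - 1)^2 * (2 * \<kappa> * q + \<beta>1) * p^3
        + q * (q - 1) * (\<delta> * q^2 + (\<gamma>2 - \<beta>2 - \<delta>) * q + \<beta>2) * p^2
        + (2 * \<kappa> * \<epsilon> * q^3 + f2 * q^2 - (2 * \<kappa> * \<epsilon> + f2 + \<beta>3 + \<gamma>3) * q + \<beta>3) * p
        + \<epsilon>^2 * q^2 + \<epsilon> * b * q)"

definition solution ::
  "params \<Rightarrow> complex set \<Rightarrow> (complex \<Rightarrow> complex) \<Rightarrow> (complex \<Rightarrow> complex) \<Rightarrow> bool" where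
  "solution a U q p \<longleftrightarrow> open U \<and>
     (\<forall>t\<in>U. (q has_field_derivative deriv (\<lambda>y. hamiltonian a (q t) y) (p t)) (at t) \<and>
            (p has_field_derivative - deriv (\<lambda>x. hamiltonian a x (p t)) (q t)) (at t))"


section \<open>The transformations\<close>

text \<open>A point is \<open>(q, p, t, a)\<close>.  Birational transformations are partial maps,
  undefined where a denominator vanishes.\<close>

type_synonym point = "complex \<times> complex \<times> complex \<times> params"

fun bt_s :: "node \<Rightarrow> point \<rightharpoonup> point" where
  "bt_s N0 (q, p, t, a) = (if p = 0 then None else
     Some (q + a N0 / p, p, t,
       a(N0 := - a N0, N1 := a N1 + a N0, N4 := a N4 + a N0, N7 := a N7 + a N0)))"
| "bt_s N1 (q, p, t, a) = (if q = 0 then None else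
     Some (q, p - a N1 / q, t, a(N0 := a N0 + a N1, N1 := - a N1, N2 := a N2 + a N1)))"
| "bt_s N2 (q, p, t, a) =
     Some (q, p, t, a(N1 := a N1 + a N2, N2 := - a N2, N3 := a N3 + a N2))"
| "bt_s N3 (q, p, t, a) =
     Some (q, p, t, a(N2 := a N2 + a N3, N3 := - a N3))"
| "bt_s N4 (q, p, t, a) = (if q - 1 = 0 then None else
     Some (q, p - a N4 / (q - 1), t, a(N0 := a N0 + a N4, N4 := - a N4, N5 := a N5 + a N4)))"
| "bt_s N5 (q, p, t, a) =
     Some (q, p, t, a(N4 := a N4 + a N5, N5 := - a N5, N6 := a N6 + a N5))"
| "bt_s N6 (q, p, t, a) =
     Some (q, p, t, a(N5 := a N5 + a N6, N6 := - a N6))"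
| "bt_s N7 (q, p, t, a) =
     Some (q, p, t, a(N0 := a N0 + a N7, N7 := - a N7))"

fun bt_pi :: "point \<rightharpoonup> point" where
  "bt_pi (q, p, t, a) = Some (1 - q, - p, t + 1,
     a(N1 := a N4, N2 := a N5, N3 := a N6, N4 := a N1, N5 := a N2, N6 := a N3))"

text \<open>The transformed pair is a pair of functions of the new time variable \<open>\<tau> t\<close>, and the
  new parameters do not depend on time.\<close>

definition baecklund :: "(point \<rightharpoonup> point) \<Rightarrow> bool" where
  "baecklund w \<longleftrightarrow>
     (\<forall>a U q p. admissible a \<and> solution a U q p \<and> (\<forall>t\<in>U. (q t, p t, t, a) \<in> dom w) \<longrightarrow>
        (\<exists>a' \<tau> Q P. admissible a' \<and> inj_on \<tau> U \<and> solution a' (\<tau> ` U) Q P \<and>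
           (\<forall>t\<in>U. w (q t, p t, t, a) = Some (Q (\<tau> t), P (\<tau> t), \<tau> t, a'))))"


section \<open>The group generated by the transformations\<close>

datatype gen = S node | Pi

primrec bt :: "gen \<Rightarrow> point \<rightharpoonup> point" where
  "bt (S i) = bt_s i"
| "bt Pi = bt_pi"

definition pinv :: "('a \<rightharpoonup> 'a) \<Rightarrow> ('a \<rightharpoonup> 'a)" where
  "pinv f y = (if y \<in> ran f then Some (SOME x. f x = Some y) else None)"

text \<open>In a word, the letter \<open>(g, True)\<close> stands for \<open>g\<close> and \<open>(g, False)\<close> for its inverse.\<close>

type_synonym 'g word = "('g \<times> bool) list"

fun word_bt :: "gen word \<Rightarrow> point \<rightharpoonup> point" where
  "word_bt [] = Some"
| "word_bt ((g, e) # u) = (if e then bt g else pinv (bt g)) \<circ>\<^sub>m word_bt u"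

text \<open>The points of the parameter hyperplane at which all words in the generators are defined:
  the complement of countably many proper hypersurfaces.  Here the generators are honest
  bijections, and words agree as birational maps iff they agree on this set.\<close>

definition regular_points :: "point set" where
  "regular_points = {(q, p, t, a). admissible a \<and> (\<forall>u. (q, p, t, a) \<in> dom (word_bt u))}"

definition bij_bt :: "gen \<Rightarrow> (point \<Rightarrow> point)" where
  "bij_bt g = (\<lambda>x\<in>regular_points. the (bt g x))"

definition baecklund_group :: "(point \<Rightarrow> point) monoid" where
  "baecklund_group = subgroup_generated (BijGroup regular_points) (range bij_bt)"

definition baecklund_subgroup_s :: "(point \<Rightarrow> point) monoid" where
  "baecklund_subgroup_s =
     subgroup_generated (BijGroup regular_points) (range (\<lambda>i. bij_bt (S i)))"

text \<open>The square of \<open>Pi\<close> is the shift of \<open>t\<close> by 2, a trivial symmetry of the autonomous system,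
  whereas the diagram automorphism has order 2.  Pure time shifts are therefore divided out.\<close>

definition time_translations :: "(point \<Rightarrow> point) set" where
  "time_translations = {g \<in> carrier baecklund_group.
     \<exists>c. \<forall>(q, p, t, a) \<in> regular_points. g (q, p, t, a) = (q, p, t + c, a)}"


section \<open>Groups given by generators and relations\<close>

text \<open>All elements of the type \<open>'g\<close> are generators, and \<open>R\<close> is the set of relators.\<close>

inductive word_eq :: "'g word set \<Rightarrow> 'g word \<Rightarrow> 'g word \<Rightarrow> bool" for R where
  refl: "word_eq R u u"
| sym: "word_eq R u v \<Longrightarrow> word_eq R v u"
| trans: "word_eq R u v \<Longrightarrow> word_eq R v w \<Longrightarrow> word_eq R u w"
| cancel: "word_eq R (u @ [(g, e), (g, \<not> e)] @ v) (u @ v)"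
| relator: "r \<in> R \<Longrightarrow> word_eq R (u @ r @ v) (u @ v)"

definition word_class :: "'g word set \<Rightarrow> 'g word \<Rightarrow> 'g word set" where
  "word_class R u = {v. word_eq R u v}"

definition presented_group :: "'g word set \<Rightarrow> ('g word set) monoid" where
  "presented_group R =
     \<lparr>carrier = range (word_class R),
      mult = (\<lambda>A B. \<Union>u\<in>A. \<Union>v\<in>B. word_class R (u @ v)),
      one = word_class R []\<rparr>"

definition affine_relators :: "node word set" where
  "affine_relators =
     {[(i, True), (i, True)] | i. True}
   \<union> {concat (replicate 3 [(i, True), (j, True)]) | i j. adjacent i j}
   \<union> {concat (replicate 2 [(i, True), (j, True)]) | i j. i \<noteq> j \<and> \<not> adjacent i j}"

text \<open>The extension by the diagram automorphism is the semidirect product with a group of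
  order 2, whose generator \<open>Pi\<close> acts on the reflections through \<open>diagram_aut\<close>.\<close>

definition extended_relators :: "gen word set" where
  "extended_relators =
     map (map_prod S id) ` affine_relators
   \<union> {[(Pi, True), (Pi, True)]}
   \<union> {[(Pi, True), (S i, True), (Pi, False), (S (diagram_aut i), False)] | i. True}"

definition affine_weyl_E7 :: "(node word set) monoid" where
  "affine_weyl_E7 = presented_group affine_relators"

definition extended_affine_weyl_E7 :: "(gen word set) monoid" where
  "extended_affine_weyl_E7 = presented_group extended_relators"

end

theory Submission
  imports Defs
begin

text \<open>Each generator is a canonical transformation that changes the Hamiltonian only by a constant,
  so it maps solutions to solutions.  The Coxeter relations are rational identities.  That there are
  no further relations is seen at first order around the parameter \<open>0\<close>, where every reflection acts
  trivially on \<open>(q, p)\<close>: for parameters \<open>x \<alpha>\<close> with \<open>x\<close> small, the linear terms in \<open>x\<close> of the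
  parameters and of \<open>q\<close> carry the geometric representation of the Coxeter group on the coroot
  lattice, which is faithful by Tits' theorem.  The hyperplane condition says that the null
  root vanishes, so translations fix the parameters and are only visible in \<open>q\<close>.
  Words of odd degree in \<open>Pi\<close> are excluded because they send \<open>q\<close> to \<open>1 - q\<close> at the parameter \<open>0\<close>.\<close>

section \<open>Symmetries of the Hamiltonian\<close>

text \<open>Words are compared only at regular points, and regularity imposes one condition for
  every word, so the first-order data cannot simply be read off near the parameter 0. The parameters
  on such a curve are the values of the simple roots on a coroot vector \<open>c\<close>, and these
  determine \<open>c\<close> only up to multiples of (4,3,2,1,3,2,1,2), which spans the kernel of
  the Cartan matrix. The missing coordinate reappears because \<open>s0\<close> is the only
  reflection that moves \<open>q\<close>, to first order by \<open>x * cartan c N0 / p\<close>, and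
  \<open>cartan c N0\<close> is exactly what this reflection subtracts from \<open>c N0\<close>. The
  displacements of \<open>q\<close> therefore telescope along a word to the total change of
  \<open>c N0\<close>. The kernel vector has a nonzero coordinate at \<open>N0\<close>, so this one
  number settles the ambiguity.\<close>

definition ham :: "complex \<Rightarrow> complex \<Rightarrow> complex \<Rightarrow> complex \<Rightarrow> complex \<Rightarrow> complex \<Rightarrow> complex
    \<Rightarrow> complex \<Rightarrow> complex \<Rightarrow> complex" where
  "ham k e b1 b2 b3 c2 c3 q p =
    q^3 * (q - 1)^3 * p^4
    + q^2 * (q - 1)^2 * (2 * k * q + b1) * p^3
    + q * (q - 1) * ((k^2 + 2 * e) * q^2 + (c2 - b2 - (k^2 + 2 * e)) * q + b2) * p^2
    + (2 * k * e * q^3 + (k * (c2 - b2) - k^3 - 2 * k * e - k^2 * b1 + e * b1) * q^2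
       - (2 * k * e + (k * (c2 - b2) - k^3 - 2 * k * e - k^2 * b1 + e * b1) + b3 + c3) * q + b3) * p
    + e^2 * q^2 + e * (c2 - b2 - k^2 - e - k * b1) * q"

text \<open>Replacing \<open>q\<close> by \<open>1 - q\<close> exchanges the two triples of
  parameters. The hypothesis is the hyperplane condition, and the constant is the value of the left
  side at \<open>q = 0\<close>, \<open>p = 0\<close>, where the Hamiltonian on the right
  vanishes.\<close>

lemma ham_pi:
  assumes "c1 = - b1 - 2 * k"
  shows "ham k e c1 c2 c3 b2 b3 (1 - q) (- p)
    = ham k e b1 b2 b3 c2 c3 q p + (e^2 + e * (b2 - c2 - k^2 - e - k * c1))"
  unfolding ham_def assms by algebra

text \<open>In the variable \<open>q p\<close>, which \<open>s1\<close> and \<open>s0\<close> merely translate, the next two identities become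
  polynomial after clearing a power of \<open>q\<close> or \<open>p\<close>.\<close>

lemma ham_s1:
  fixes q :: complex
  assumes "q \<noteq> 0"
    and "k = 2 * x + y" "e = x * (x + y)"
    and "b1 = a + r" "b2 = a * r + s" "b3 = a * s"
    and "k' = k + 2 * a" "e' = (x + a) * (x + a + y)"
    and "b1' = b1 - 4 * a" "b2' = - a * (r - 2 * a) + (s - r * a + a^2)" 
    and "b3' = - a * (s - r * a + a^2)"
    and "g = - b1 - 2 * k"
    and "c = c3 * a + e'^2 + e' * (c2 - b2' - k'^2 - e' - k' * b1')
               - e^2 - e * (c2 - b2 - k^2 - e - k * b1)"
  shows "ham k' e' b1' b2' b3' c2 c3 q (p - a / q) = ham k e b1 b2 b3 c2 c3 q p + c"
proof -
  define z where "z = q * p"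
  have px: "p = z / q" "p - a / q = (z - a) / q" using assms(1) by (auto simp: z_def field_simps)
  have *: "q * ham k e b1 b2 b3 c2 c3 q (z / q) = 
    (q - 1)^3 * z^4
    + (q - 1)^2 * (2 * k * q + b1) * z^3
    + (q - 1) * ((k^2 + 2 * e) * q^2 + (c2 - b2 - (k^2 + 2 * e)) * q + b2) * z^2
    + (2 * k * e * q^3 + (k * (c2 - b2) - k^3 - 2 * k * e - k^2 * b1 + e * b1) * q^2
       - (2 * k * e + (k * (c2 - b2) - k^3 - 2 * k * e - k^2 * b1 + e * b1) + b3 + c3) * q + b3) * z
    + e^2 * q^3 + e * (c2 - b2 - k^2 - e - k * b1) * q^2" for k e b1 b2 b3 c2 c3 z
  proof -
    define y where "y = z / q"
    have "z = q * y" using assms(1) by (simp add: y_def)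
    then show ?thesis unfolding y_def[symmetric] ham_def by algebra
  qed
  \<comment> \<open>If \<open>b1\<close>, \<open>b2\<close>, \<open>b3\<close> belong to the triple
    \<open>a\<close>, \<open>u\<close>, \<open>v\<close> with \<open>u + v = r\<close> and
    \<open>u * v = s\<close>, the primed ones belong to \<open>- a\<close>, \<open>u - a\<close>,
    \<open>v - a\<close>. The constant \<open>c\<close> is the difference of the two Hamiltonians at
    \<open>q = 1\<close>, where only \<open>- c3 * p\<close> and the terms free of \<open>p\<close>
    survive.\<close>
  have "q * ham k' e' b1' b2' b3' c2 c3 q ((z - a) / q) = q * (ham k e b1 b2 b3 c2 c3 q (z / q) + c)"
    unfolding distrib_left * 
    unfolding assms(2-)
    by algebra
  then show ?thesis using assms(1) px by simp
qed

lemma ham_s0: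
  fixes p :: complex
  assumes "p \<noteq> 0"
    and "k = 2 * a + a7" "e = a * (a + a7)"
    and "k' = a7 - a" "e' = - a * a7"
    and "b1' = b1 + 3 * a" "b2' = b2 + 2 * a * b1 + 3 * a^2" "b3' = b3 + a * b2 + a^2 * b1 + a^3"
    and "c1 = - b1 - 2 * k"
    and "c2' = c2 + 2 * a * c1 + 3 * a^2" "c3' = c3 + a * c2 + a^2 * c1 + a^3"
    and "c = 3 * a^4 + (2 * k' - 2 * b1') * a^3 + (2 * b2' - c2' + k'^2 + 2 * e') * a^2
       - (2 * k' * e' + (k' * (c2' - b2') - k'^3 - 2 * k' * e' - k'^2 * b1' + e' * b1') + b3' + c3') * a"
  shows "ham k' e' b1' b2' b3' c2' c3' (q + a / p) p = ham k e b1 b2 b3 c2 c3 q p + c"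
proof -
  define x where "x = q * p"
  have px: "q = x / p" "q + a / p = (x + a) / p" using assms(1) by (auto simp: x_def field_simps)
  have *: "p^2 * ham k e b1 b2 b3 c2 c3 (x / p) p = 
    x^3 * (x - p)^3
    + x^2 * (x - p)^2 * (2 * k * x + b1 * p)
    + x * (x - p) * ((k^2 + 2 * e) * x^2 + (c2 - b2 - (k^2 + 2 * e)) * x * p + b2 * p^2)
    + (2 * k * e * x^3 + (k * (c2 - b2) - k^3 - 2 * k * e - k^2 * b1 + e * b1) * x^2 * p
       - (2 * k * e + (k * (c2 - b2) - k^3 - 2 * k * e - k^2 * b1 + e * b1) + b3 + c3) * x * p^2 + b3 * p^3)
    + e^2 * x^2 + e * (c2 - b2 - k^2 - e - k * b1) * x * p" for k e b1 b2 b3 c2 c3 x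
  proof -
    define y where "y = x / p"
    have "x = p * y" using assms(1) by (simp add: y_def)
    then show ?thesis unfolding y_def[symmetric] ham_def by algebra
  qed
  \<comment> \<open>Here \<open>s0\<close> shifts every member of both triples by \<open>a\<close>.
    The constant \<open>c\<close> is found at \<open>x = 0\<close>, as the coefficient of
    \<open>p^2\<close> on the cleared left side.\<close>
  have "p^2 * ham k' e' b1' b2' b3' c2' c3' ((x + a) / p) p = p^2 * (ham k e b1 b2 b3 c2 c3 (x / p) p + c)"
    unfolding distrib_left * 
    unfolding assms(2-)
    by algebra
  then show ?thesis using assms(1) px by simp
qed

text \<open>The arguments \<open>c2\<close>, \<open>c3\<close> are \<gamma>2 and \<gamma>3. The
  Hamiltonian does not contain \<gamma>1, which on the hyperplane equals
  \<open>- b1 - 2 * k\<close>; this is how the condition enters \<open>ham_pi\<close> and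
  \<open>ham_s0\<close>.\<close>

lemma hamiltonian_ham:
  "hamiltonian a = ham (2 * a N0 + a N7) (a N0 * (a N0 + a N7))
    (esym1 (a N1) (a N1 + a N2) (a N1 + a N2 + a N3))
    (esym2 (a N1) (a N1 + a N2) (a N1 + a N2 + a N3))
    (esym3 (a N1) (a N1 + a N2) (a N1 + a N2 + a N3))
    (esym2 (a N4) (a N4 + a N5) (a N4 + a N5 + a N6))
    (esym3 (a N4) (a N4 + a N5) (a N4 + a N5 + a N6))"
  by (intro ext) (simp add: hamiltonian_def ham_def Let_def)

text \<open>Differentiability in two variables, encoded as the chain rule along arbitrary curves
  through the point. It is applied to solution curves and to coordinate lines; the latter give the
  partial derivatives in \<open>solution\<close>.\<close>

definition partials_at ::
  "(complex \<Rightarrow> complex \<Rightarrow> complex) \<Rightarrow> complex \<Rightarrow> complex \<Rightarrow> complex \<Rightarrow> complex \<Rightarrow> bool" where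
  "partials_at H hx hy x y \<longleftrightarrow>
     (\<forall>f g f' g' z. f z = x \<and> g z = y \<and> (f has_field_derivative f') (at z) \<and>
        (g has_field_derivative g') (at z) \<longrightarrow>
        ((\<lambda>z. H (f z) (g z)) has_field_derivative hx * f' + hy * g') (at z))"

lemma partials_atI:
  assumes "\<And>f g f' g' z. \<lbrakk>f z = x; g z = y; (f has_field_derivative f') (at z);
      (g has_field_derivative g') (at z)\<rbrakk> \<Longrightarrow>
      ((\<lambda>z. H (f z) (g z)) has_field_derivative hx * f' + hy * g') (at z)"
  shows "partials_at H hx hy x y"
  using assms by (auto simp: partials_at_def)

lemma partials_atD:
  assumes "partials_at H hx hy x y" "f z = x" "g z = y"
    "(f has_field_derivative f') (at z)" "(g has_field_derivative g') (at z)"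
  shows "((\<lambda>z. H (f z) (g z)) has_field_derivative hx * f' + hy * g') (at z)"
  using assms by (auto simp: partials_at_def)

lemma partials_at_partials:
  assumes "partials_at H hx hy x y"
  shows "((\<lambda>z. H z y) has_field_derivative hx) (at x)"
    and "(H x has_field_derivative hy) (at y)"
  using partials_atD[OF assms, of "\<lambda>z. z" x "\<lambda>_. y" 1 0]
    partials_atD[OF assms, of "\<lambda>_. x" y "\<lambda>z. z" 0 1] by auto

lemma partials_at_deriv:
  assumes "partials_at H hx hy x y"
  shows "deriv (\<lambda>z. H z y) x = hx" "deriv (H x) y = hy"
  using partials_at_partials[OF assms] by (auto intro: DERIV_imp_deriv)

lemma hamiltonian_partials: "\<exists>hx hy. partials_at (hamiltonian a) hx hy x y"
proof -
  have "\<exists>hx hy. partials_at (ham k e b1 b2 b3 c2 c3) hx hy x y" for k e b1 b2 b3 c2 c3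
  proof (intro exI partials_atI)
    fix f g :: "complex \<Rightarrow> complex" and f' g' z
    \<comment> \<open>Naming the coefficients that are free of both variables keeps the derivative
      rules from descending into them.\<close>
    define D where "D = k^2 + 2 * e"
    define m where "m = c2 - b2 - D"
    define F where "F = k * (c2 - b2) - k^3 - 2 * k * e - k^2 * b1 + e * b1"
    define n where "n = 2 * k * e + F + b3 + c3"
    define v where "v = c2 - b2 - k^2 - e - k * b1"
    assume xy: "f z = x" "g z = y"
      and [derivative_intros]: "(f has_field_derivative f') (at z)" "(g has_field_derivative g') (at z)"
    show "((\<lambda>z. ham k e b1 b2 b3 c2 c3 (f z) (g z)) has_field_derivative
       ((3*x^2*(x-1)^3 + 3*x^3*(x-1)^2) * y^4
        + ((2*x*(x-1)^2 + 2*x^2*(x-1)) * (2*k*x + b1) + x^2*(x-1)^2*(2*k)) * y^3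
        + ((2*x-1) * (D*x^2 + m*x + b2) + x*(x-1)*(2*D*x+m)) * y^2
        + (6*k*e*x^2 + 2*F*x - n) * y + 2*e^2*x + e * v) * f'
     + (4*x^3*(x-1)^3*y^3 + 3*x^2*(x-1)^2*(2*k*x+b1)*y^2 + 2*x*(x-1)*(D*x^2 + m*x + b2)*y
        + (2*k*e*x^3 + F*x^2 - n*x + b3)) * g') (at z)"
      unfolding ham_def D_def[symmetric] m_def[symmetric] F_def[symmetric] n_def[symmetric] v_def[symmetric]
      apply (rule derivative_eq_intros HOL.refl)+
      apply (simp add: xy)
      by algebra
  qed
  then show ?thesis by (simp add: hamiltonian_ham)
qed

text \<open>In one degree of freedom, Jacobian determinant 1 is the symplectic condition.
  Differentiating \<open>H' (F x y) (G x y) = H x y + c\<close> along the coordinate lines expresses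
  \<open>hx\<close>, \<open>hy\<close> through \<open>hx'\<close>, \<open>hy'\<close> by the
  transposed Jacobian; the determinant inverts this, so one Hamiltonian vector field is carried to
  the other.\<close>

lemma canonical_transformation:
  assumes "partials_at H hx hy x y" "partials_at H' hx' hy' (F x y) (G x y)"
    and F: "partials_at F fx fy x y" and G: "partials_at G gx gy x y"
    and det: "fx * gy - fy * gx = 1"
    and x: "\<forall>\<^sub>F z in nhds x. H' (F z y) (G z y) = H z y + c"
    and y: "\<forall>\<^sub>F z in nhds y. H' (F x z) (G x z) = H x z + c"
  shows "fx * hy + fy * (- hx) = hy'" "gx * hy + gy * (- hx) = - hx'"
proof -
  have "((\<lambda>z. H' (F z y) (G z y)) has_field_derivative hx' * fx + hy' * gx) (at x)"
    by (rule partials_atD[OF assms(2)]) (use partials_at_partials F G in auto)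
  moreover have "((\<lambda>z. H z y + c) has_field_derivative hx) (at x)"
    using partials_at_partials(1)[OF assms(1)] by (auto intro!: derivative_eq_intros)
  ultimately have 1: "hx = hx' * fx + hy' * gx"
    using x by (metis DERIV_unique DERIV_cong_ev)
  have "((\<lambda>z. H' (F x z) (G x z)) has_field_derivative hx' * fy + hy' * gy) (at y)"
    by (rule partials_atD[OF assms(2)]) (use partials_at_partials F G in auto)
  moreover have "((\<lambda>z. H x z + c) has_field_derivative hy) (at y)"
    using partials_at_partials(2)[OF assms(1)] by (auto intro!: derivative_eq_intros)
  ultimately have 2: "hy = hx' * fy + hy' * gy"
    using y by (metis DERIV_unique DERIV_cong_ev)
  show "fx * hy + fy * (- hx) = hy'" unfolding 1 2 using det by algebra
  show "gx * hy + gy * (- hx) = - hx'" unfolding 1 2 using det by algebra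
qed

text \<open>The common shape of all generators: a canonical map with time shift \<open>d\<close>,
  defined where \<open>D\<close> holds. Openness of \<open>D\<close> is asked along the two
  coordinate lines, because the identity between the Hamiltonians is differentiated there.\<close>

lemma baecklundI:
  assumes w: "\<And>a q p t. w (q,p,t,a) = (if D q p then Some (F a q p, G a q p, t + d, A a) else None)"
    and adm: "\<And>a. admissible a \<Longrightarrow> admissible (A a)"
    and D: "\<And>q p. D q p \<Longrightarrow> (\<forall>\<^sub>F z in nhds q. D z p) \<and> (\<forall>\<^sub>F z in nhds p. D q z)"
    and ham: "\<And>a. admissible a \<Longrightarrow> \<exists>c. \<forall>q p. D q p \<longrightarrow>
        hamiltonian (A a) (F a q p) (G a q p) = hamiltonian a q p + c"
    and par: "\<And>a q p. D q p \<Longrightarrow> \<exists>fx fy gx gy. partials_at (F a) fx fy q p \<and>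
        partials_at (G a) gx gy q p \<and> fx * gy - fy * gx = 1"
  shows "baecklund w"
  unfolding baecklund_def
proof (intro allI impI, elim conjE)
  fix a U q p
  assume a: "admissible a" and sol: "solution a U q p" and dom: "\<forall>t\<in>U. (q t, p t, t, a) \<in> dom w"
  have D': "D (q t) (p t)" if "t \<in> U" for t
    using dom that w by (auto simp: dom_def split: if_splits)
  define Q where "Q = (\<lambda>s. F a (q (s - d)) (p (s - d)))"
  define P where "P = (\<lambda>s. G a (q (s - d)) (p (s - d)))"
  have im: "(\<lambda>t. t + d) ` U = (\<lambda>t. d + t) ` U" by (auto simp: add.commute)
  have op: "open ((\<lambda>t. t + d) ` U)"
    unfolding im by (rule open_translation) (use sol in \<open>simp add: solution_def\<close>)
  obtain c where c: "\<And>q p. D q p \<Longrightarrow>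
        hamiltonian (A a) (F a q p) (G a q p) = hamiltonian a q p + c" using ham[OF a] by blast
  have "(Q has_field_derivative deriv (\<lambda>y. hamiltonian (A a) (Q (t + d)) y) (P (t + d))) (at (t + d)) \<and>
        (P has_field_derivative - deriv (\<lambda>x. hamiltonian (A a) x (P (t + d))) (Q (t + d))) (at (t + d))"
    if t: "t \<in> U" for t
  proof -
    obtain hx hy where h: "partials_at (hamiltonian a) hx hy (q t) (p t)"
      using hamiltonian_partials by blast
    obtain hx' hy' where h': "partials_at (hamiltonian (A a)) hx' hy' (F a (q t) (p t)) (G a (q t) (p t))"
      using hamiltonian_partials by blast
    obtain fx fy gx gy where f: "partials_at (F a) fx fy (q t) (p t)"
      and g: "partials_at (G a) gx gy (q t) (p t)" and det: "fx * gy - fy * gx = 1"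
      using par[OF D'[OF t]] by blast
    have ev: "\<forall>\<^sub>F z in nhds (q t). hamiltonian (A a) (F a z (p t)) (G a z (p t)) = hamiltonian a z (p t) + c"
       "\<forall>\<^sub>F z in nhds (p t). hamiltonian (A a) (F a (q t) z) (G a (q t) z) = hamiltonian a (q t) z + c"
      using D[OF D'[OF t]] c by (auto elim: eventually_mono)
    have "((\<lambda>s. q (s - d)) has_field_derivative hy) (at (t + d))"
      "((\<lambda>s. p (s - d)) has_field_derivative - hx) (at (t + d))"
      using sol t DERIV_shift[of "\<lambda>s. q (s - d)" _ t d] DERIV_shift[of "\<lambda>s. p (s - d)" _ t d]
      by (auto simp: solution_def partials_at_deriv[OF h])
    note qp = this
    have "(Q has_field_derivative fx * hy + fy * (- hx)) (at (t + d))"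
      unfolding Q_def by (rule partials_atD[OF f]) (use qp in auto)
    moreover have "(P has_field_derivative gx * hy + gy * (- hx)) (at (t + d))"
      unfolding P_def by (rule partials_atD[OF g]) (use qp in auto)
    moreover have "deriv (\<lambda>y. hamiltonian (A a) (Q (t + d)) y) (P (t + d)) = hy'"
      "deriv (\<lambda>x. hamiltonian (A a) x (P (t + d))) (Q (t + d)) = hx'"
      using partials_at_deriv[OF h'] by (simp_all add: P_def Q_def)
    ultimately show ?thesis
      by (simp only: canonical_transformation[OF h h' f g det ev])
  qed
  then have "solution (A a) ((\<lambda>t. t + d) ` U) Q P"
    using op by (auto simp: solution_def)
  moreover have "w (q t, p t, t, a) = Some (Q (t + d), P (t + d), t + d, A a)" if "t \<in> U" for t
    using D'[OF that] by (simp add: w Q_def P_def)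
  ultimately show "\<exists>a' \<tau> Q P. admissible a' \<and> inj_on \<tau> U \<and> solution a' (\<tau> ` U) Q P \<and>
           (\<forall>t\<in>U. w (q t, p t, t, a) = Some (Q (\<tau> t), P (\<tau> t), \<tau> t, a'))"
    using adm[OF a] by (intro exI[of _ "A a"] exI[of _ "\<lambda>t. t + d"] exI[of _ Q] exI[of _ P]) auto
qed

lemma baecklund_comp:
  assumes w: "baecklund w" and v: "baecklund v"
  shows "baecklund (w \<circ>\<^sub>m v)"
  unfolding baecklund_def
proof (intro allI impI, elim conjE)
  fix a U q p
  assume a: "admissible a" and sol: "solution a U q p" and dom: "\<forall>t\<in>U. (q t, p t, t, a) \<in> dom (w \<circ>\<^sub>m v)"
  then have "\<forall>t\<in>U. (q t, p t, t, a) \<in> dom v"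
    by (auto simp: dom_def map_comp_def split: option.splits)
  then obtain b \<tau> Q P where b: "admissible b" "inj_on \<tau> U" "solution b (\<tau> ` U) Q P"
    and vv: "\<forall>t\<in>U. v (q t, p t, t, a) = Some (Q (\<tau> t), P (\<tau> t), \<tau> t, b)"
    using v[unfolded baecklund_def, rule_format, of a U q p] a sol by blast
  have "\<forall>s\<in>\<tau> ` U. (Q s, P s, s, b) \<in> dom w"
    using dom vv by (fastforce simp: dom_def map_comp_def split: option.splits)
  then obtain b' \<tau>' Q' P' where b': "admissible b'" "inj_on \<tau>' (\<tau> ` U)" "solution b' (\<tau>' ` \<tau> ` U) Q' P'"
    and ww: "\<forall>s\<in>\<tau> ` U. w (Q s, P s, s, b) = Some (Q' (\<tau>' s), P' (\<tau>' s), \<tau>' s, b')"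
    using w[unfolded baecklund_def, rule_format, of b "\<tau> ` U" Q P] b by blast
  show "\<exists>a' \<tau> Q P. admissible a' \<and> inj_on \<tau> U \<and> solution a' (\<tau> ` U) Q P \<and>
           (\<forall>t\<in>U. (w \<circ>\<^sub>m v) (q t, p t, t, a) = Some (Q (\<tau> t), P (\<tau> t), \<tau> t, a'))"
    using b b' vv ww
    by (intro exI[of _ b'] exI[of _ "\<tau>' \<circ> \<tau>"] exI[of _ Q'] exI[of _ P'])
       (auto simp: comp_inj_on image_comp)
qed

lemma baecklund_Some: "baecklund Some"
  unfolding baecklund_def
proof (intro allI impI, elim conjE)
  fix a U q p assume "admissible a" "solution a U q p"
  then show "\<exists>a' \<tau> Q P. admissible a' \<and> inj_on \<tau> U \<and> solution a' (\<tau> ` U) Q P \<and>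
           (\<forall>t\<in>U. Some (q t, p t, t, a) = Some (Q (\<tau> t), P (\<tau> t), \<tau> t, a'))"
    by (intro exI[of _ a] exI[of _ "\<lambda>t. t"] exI[of _ q] exI[of _ p]) auto
qed

lemma ham_s1_ex:
  assumes "k = 2 * x + y" "e = x * (x + y)"
    and "b1 = a + r" "b2 = a * r + s" "b3 = a * s"
    and "k' = k + 2 * a" "e' = (x + a) * (x + a + y)"
    and "b1' = b1 - 4 * a" "b2' = - a * (r - 2 * a) + (s - r * a + a^2)" 
    and "b3' = - a * (s - r * a + a^2)"
    and "g = - b1 - 2 * k"
  shows "\<exists>c. \<forall>q p. q \<noteq> 0 \<longrightarrow>
     ham k' e' b1' b2' b3' c2 c3 q (p - a / q) = ham k e b1 b2 b3 c2 c3 q p + c"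
  using ham_s1[OF _ assms HOL.refl] by blast

lemma UNIV_node: "UNIV = {N0, N1, N2, N3, N4, N5, N6, N7}"
proof -
  have "x \<in> {N0, N1, N2, N3, N4, N5, N6, N7}" for x by (cases x) auto
  then show ?thesis by auto
qed

section \<open>Inverses of the generators and the diagram symmetry\<close>

lemma pinv_eqI:
  assumes "\<And>x y. f x = Some y \<longleftrightarrow> g y = Some x"
  shows "pinv f = g"
proof
  fix y
  show "pinv f y = g y"
  proof (cases "g y")
    case None
    then show ?thesis using assms by (auto simp: pinv_def ran_def)
  next
    case (Some x)
    then have "f x = Some y" "\<And>z. f z = Some y \<Longrightarrow> z = x" using assms by auto
    then have "(SOME x. f x = Some y) = x" "y \<in> ran f" by (blast intro: ranI)+
    then show ?thesis using Some by (simp add: pinv_def)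
  qed
qed

lemma bt_s_involution: "bt_s i x = Some y \<Longrightarrow> bt_s i y = Some x"
  by (cases x; cases i) (auto split: if_splits simp: fun_eq_iff)

lemma pinv_bt_s: "pinv (bt_s i) = bt_s i"
  by (rule pinv_eqI) (blast dest: bt_s_involution)

lemma params_eqI:
  fixes a b :: "node \<Rightarrow> 'a"
  assumes "a N0 = b N0" "a N1 = b N1" "a N2 = b N2" "a N3 = b N3"
    "a N4 = b N4" "a N5 = b N5" "a N6 = b N6" "a N7 = b N7"
  shows "a = b"
proof
  show "a i = b i" for i using assms by (cases i) auto
qed

definition bt_pi_inv :: "point \<rightharpoonup> point" where
  "bt_pi_inv = (\<lambda>(q, p, t, a). Some (1 - q, - p, t - 1,
     a(N1 := a N4, N2 := a N5, N3 := a N6, N4 := a N1, N5 := a N2, N6 := a N3)))"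

lemma permute_pi: "a(N1 := a N4, N2 := a N5, N3 := a N6, N4 := a N1, N5 := a N2, N6 := a N3) = a \<circ> diagram_aut"
proof
  fix x show "(a(N1 := a N4, N2 := a N5, N3 := a N6, N4 := a N1, N5 := a N2, N6 := a N3)) x = (a \<circ> diagram_aut) x"
    by (cases x) auto
qed

lemma diagram_aut_involution [simp]: "diagram_aut (diagram_aut i) = i"
  by (cases i) auto

lemma comp_diagram_aut: "a' = a \<circ> diagram_aut \<longleftrightarrow> a = a' \<circ> diagram_aut"
  by (auto simp: fun_eq_iff)

lemma pinv_bt_pi: "pinv bt_pi = bt_pi_inv"
proof (rule pinv_eqI)
  fix x y :: point
  obtain q p t a q' p' t' a' where xy: "x = (q, p, t, a)" "y = (q', p', t', a')"
    by (metis prod_cases4)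
  show "bt_pi x = Some y \<longleftrightarrow> bt_pi_inv y = Some x"
    unfolding xy bt_pi_inv_def bt_pi.simps permute_pi case_prod_conv option.inject prod.inject
    using comp_diagram_aut[of a a'] by (auto simp: algebra_simps)
qed

section \<open>The Baecklund property of the individual generators\<close>

lemma partials_at_fst: "partials_at (\<lambda>q p. q) 1 0 x y"
  and partials_at_snd: "partials_at (\<lambda>q p. p) 0 1 x y"
  by (auto intro!: partials_atI)

text \<open>For the five reflections that fix \<open>q\<close> and \<open>p\<close>. The Hamiltonian
  sees each triple only through symmetric functions; \<open>s2\<close>, \<open>s3\<close> permute
  the first triple, \<open>s5\<close>, \<open>s6\<close> the second, and \<open>s7\<close> swaps
  \<alpha>0 with \<alpha>0 + \<alpha>7, preserving \<kappa> and \<epsilon>.\<close>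

lemma baecklund_params:
  assumes "\<And>q p t a. w (q, p, t, a) = Some (q, p, t, A a)"
    and "\<And>a. admissible a \<Longrightarrow> admissible (A a)"
    and "\<And>a. admissible a \<Longrightarrow> hamiltonian (A a) = hamiltonian a"
  shows "baecklund w"
proof (rule baecklundI[where D = "\<lambda>_ _. True" and F = "\<lambda>a q p. q" and G = "\<lambda>a q p. p" and d = 0 and A = A])
  fix a :: params and q p
  show "\<exists>fx fy gx gy. partials_at (\<lambda>q p. q) fx fy q p \<and>
        partials_at (\<lambda>q p. p) gx gy q p \<and> fx * gy - fy * gx = 1"
    using partials_at_fst partials_at_snd by (intro exI conjI) auto
  assume "admissible a"
  then show "\<exists>c. \<forall>q p. True \<longrightarrow> hamiltonian (A a) q p = hamiltonian a q p + c"
    using assms(3) by (intro exI[of _ 0]) simp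
qed (auto simp: assms)

lemma baecklund_s0: "baecklund (bt_s N0)"
proof (rule baecklundI[where D = "\<lambda>_ p. p \<noteq> 0" and F = "\<lambda>a q p. q + a N0 / p" and G = "\<lambda>a q p. p" and d = 0])
  fix q p t and a :: params
  show "bt_s N0 (q, p, t, a) = (if p \<noteq> 0 then Some (q + a N0 / p, p, t + 0, a(N0 := - a N0, N1 := a N1 + a N0, N4 := a N4 + a N0, N7 := a N7 + a N0)) else None)"
    by simp
next
  fix a :: params
  let ?A = "a(N0 := - a N0, N1 := a N1 + a N0, N4 := a N4 + a N0, N7 := a N7 + a N0)"
  assume a: "admissible a"
  then show "admissible ?A"
    by (simp add: admissible_def algebra_simps)
  have c1: "esym1 (a N4) (a N4 + a N5) (a N4 + a N5 + a N6)
       = - esym1 (a N1) (a N1 + a N2) (a N1 + a N2 + a N3) - 2 * (2 * a N0 + a N7)"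
    using a unfolding admissible_def esym1_def by algebra
  show "\<exists>c. \<forall>q p. p \<noteq> 0 \<longrightarrow> hamiltonian ?A (q + a N0 / p) p = hamiltonian a q p + c"
    unfolding hamiltonian_ham
    by (intro exI allI impI, rule ham_s0[OF _ HOL.refl HOL.refl _ _ _ _ _ c1 _ _ HOL.refl])
      (simp_all add: esym1_def esym2_def esym3_def algebra_simps power2_eq_square power3_eq_cube)
next
  fix a :: params and q p :: complex assume p: "p \<noteq> 0"
  then have "\<forall>\<^sub>F z in nhds p. z \<noteq> 0"
    by (simp add: t1_space_nhds)
  then show "(\<forall>\<^sub>F z in nhds q. p \<noteq> 0) \<and> (\<forall>\<^sub>F z in nhds p. z \<noteq> 0)" using p by simp
  have "partials_at (\<lambda>q p. q + a N0 / p) 1 (- a N0 / p^2) q p"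
    by (rule partials_atI) (use p in \<open>auto intro!: derivative_eq_intros simp: power2_eq_square\<close>)
  then show "\<exists>fx fy gx gy. partials_at (\<lambda>q p. q + a N0 / p) fx fy q p \<and>
        partials_at (\<lambda>q p. p) gx gy q p \<and> fx * gy - fy * gx = 1"
    using partials_at_snd[of q p] by (intro exI conjI) auto
qed

lemma baecklund_s1: "baecklund (bt_s N1)"
proof (rule baecklundI[where D = "\<lambda>q _. q \<noteq> 0" and F = "\<lambda>a q p. q" and G = "\<lambda>a q p. p - a N1 / q" and d = 0])
  fix q p t and a :: params
  show "bt_s N1 (q, p, t, a) = (if q \<noteq> 0 then Some (q, p - a N1 / q, t + 0, a(N0 := a N0 + a N1, N1 := - a N1, N2 := a N2 + a N1)) else None)"
    by simp
next
  fix a :: params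
  let ?A = "a(N0 := a N0 + a N1, N1 := - a N1, N2 := a N2 + a N1)"
  assume a: "admissible a"
  then show "admissible ?A"
    by (simp add: admissible_def algebra_simps)
  have c1: "esym1 (a N4) (a N4 + a N5) (a N4 + a N5 + a N6)
       = - esym1 (a N1) (a N1 + a N2) (a N1 + a N2 + a N3) - 2 * (2 * a N0 + a N7)"
    using a unfolding admissible_def esym1_def by algebra
  show "\<exists>c. \<forall>q p. q \<noteq> 0 \<longrightarrow> hamiltonian ?A q (p - a N1 / q) = hamiltonian a q p + c"
    unfolding hamiltonian_ham
    by (simp only: fun_upd_apply node.simps simp_thms if_True if_False,
        rule ham_s1_ex[where r = "(a N1 + a N2) + (a N1 + a N2 + a N3)"
          and s = "(a N1 + a N2) * (a N1 + a N2 + a N3)" and x = "a N0" and y = "a N7"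
          and g = "esym1 (a N4) (a N4 + a N5) (a N4 + a N5 + a N6)", OF HOL.refl HOL.refl _ _ _ _ _ _ _ _ c1])
      (simp_all add: esym1_def esym2_def esym3_def algebra_simps power2_eq_square)
next
  fix a :: params and q p :: complex assume q: "q \<noteq> 0"
  then have "\<forall>\<^sub>F z in nhds q. z \<noteq> 0"
    by (simp add: t1_space_nhds)
  then show "(\<forall>\<^sub>F z in nhds q. z \<noteq> 0) \<and> (\<forall>\<^sub>F z in nhds p. q \<noteq> 0)" using q by simp
  have "partials_at (\<lambda>q p. p - a N1 / q) (a N1 / q^2) 1 q p"
    by (rule partials_atI) (use q in \<open>auto intro!: derivative_eq_intros simp: power2_eq_square\<close>)
  then show "\<exists>fx fy gx gy. partials_at (\<lambda>q p. q) fx fy q p \<and>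
        partials_at (\<lambda>q p. p - a N1 / q) gx gy q p \<and> fx * gy - fy * gx = 1"
    using partials_at_fst[of q p] by (intro exI conjI) auto
qed

text \<open>Serves \<open>bt_pi\<close> and its inverse alike: since \<open>diagram_aut\<close> is
  an involution, they differ only in the sign of \<open>d\<close>.\<close>

lemma baecklund_reflect:
  assumes w: "\<And>q p t a. w (q, p, t, a) = Some (1 - q, - p, t + d, a \<circ> diagram_aut)"
  shows "baecklund w"
proof (rule baecklundI[where D = "\<lambda>_ _. True" and F = "\<lambda>a q p. 1 - q" and G = "\<lambda>a q p. - p" and d = d])
  fix q p t and a :: params
  show "w (q, p, t, a) = (if True then Some (1 - q, - p, t + d, a \<circ> diagram_aut) else None)"
    using w by simp
next
  fix a :: params
  assume a: "admissible a"
  then show "admissible (a \<circ> diagram_aut)"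
    by (simp add: admissible_def algebra_simps)
  have c1: "esym1 (a N4) (a N4 + a N5) (a N4 + a N5 + a N6)
       = - esym1 (a N1) (a N1 + a N2) (a N1 + a N2 + a N3) - 2 * (2 * a N0 + a N7)"
    using a unfolding admissible_def esym1_def by algebra
  show "\<exists>c. \<forall>q p. True \<longrightarrow> hamiltonian (a \<circ> diagram_aut) (1 - q) (- p) = hamiltonian a q p + c"
    using ham_pi[OF c1] unfolding hamiltonian_ham o_def diagram_aut.simps by blast
next
  fix a :: params and q p :: complex
  show "(\<forall>\<^sub>F z in nhds q. True) \<and> (\<forall>\<^sub>F z in nhds p. True)" by simp
  have "partials_at (\<lambda>q p. 1 - q) (- 1) 0 q p" "partials_at (\<lambda>q p. - p) 0 (- 1) q p"
    by (auto intro!: partials_atI derivative_eq_intros)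
  then show "\<exists>fx fy gx gy. partials_at (\<lambda>q p. 1 - q) fx fy q p \<and>
        partials_at (\<lambda>q p. - p) gx gy q p \<and> fx * gy - fy * gx = 1"
    by (intro exI conjI) auto
qed

lemma baecklund_pi: "baecklund bt_pi"
  by (rule baecklund_reflect[where d = 1]) (simp only: bt_pi.simps permute_pi)

lemma baecklund_pi_inv: "baecklund bt_pi_inv"
  by (rule baecklund_reflect[where d = "-1"]) (simp add: bt_pi_inv_def permute_pi)

text \<open>An equality of partial maps, so domains must match too: under \<open>q\<close> to
  \<open>1 - q\<close> the denominator of \<open>s1\<close> becomes, up to sign, that of
  \<open>s4\<close>.\<close>

lemma bt_pi_bt_s: "bt_pi \<circ>\<^sub>m bt_s i = bt_s (diagram_aut i) \<circ>\<^sub>m bt_pi"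
proof
  fix x :: point
  obtain q p t a where x: "x = (q, p, t, a)" by (metis prod_cases4)
  have *: "1 - q - 1 = - q" "a N4 / (1 - q) = - (a N4 / (q - 1))" "1 = q \<longleftrightarrow> q = 1"
    by (auto simp: minus_divide_right)
  show "(bt_pi \<circ>\<^sub>m bt_s i) x = (bt_s (diagram_aut i) \<circ>\<^sub>m bt_pi) x"
    unfolding x by (cases i) (simp_all add: *, (intro impI params_eqI; simp)+)
qed

lemma bt_pi_inv_pi: "bt_pi \<circ>\<^sub>m bt_pi_inv = Some" "bt_pi_inv \<circ>\<^sub>m bt_pi = Some"
  by (auto simp: map_comp_def bt_pi_inv_def fun_eq_iff)

lemma map_comp_assoc: "(f \<circ>\<^sub>m g) \<circ>\<^sub>m h = f \<circ>\<^sub>m (g \<circ>\<^sub>m h)"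
  by (auto simp: map_comp_def fun_eq_iff split: option.splits)

lemma map_comp_Some: "f \<circ>\<^sub>m Some = f" "Some \<circ>\<^sub>m f = f"
  by (auto simp: map_comp_def fun_eq_iff split: option.splits)

lemma baecklund_s: "baecklund (bt_s i)"
proof (cases i)
  case N4
  \<comment> \<open>Conjugation by \<open>Pi\<close> reduces \<open>s4\<close> to \<open>s1\<close>
    and saves a separate identity for the Hamiltonian.\<close>
  have "bt_s N4 = bt_pi \<circ>\<^sub>m bt_s N1 \<circ>\<^sub>m bt_pi_inv"
    by (simp add: bt_pi_bt_s map_comp_assoc bt_pi_inv_pi map_comp_Some)
  then show ?thesis
    using N4 baecklund_comp baecklund_pi baecklund_s1 baecklund_pi_inv by metis
next
  case N0 then show ?thesis using baecklund_s0 by simp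
next
  case N1 then show ?thesis using baecklund_s1 by simp
next
  case N2 show ?thesis unfolding N2
    by (rule baecklund_params[OF bt_s.simps(3)])
      (simp_all add: admissible_def hamiltonian_ham esym1_def esym2_def esym3_def algebra_simps)
next
  case N3 show ?thesis unfolding N3
    by (rule baecklund_params[OF bt_s.simps(4)])
      (simp_all add: admissible_def hamiltonian_ham esym1_def esym2_def esym3_def algebra_simps)
next
  case N5 show ?thesis unfolding N5
    by (rule baecklund_params[OF bt_s.simps(6)])
      (simp_all add: admissible_def hamiltonian_ham esym1_def esym2_def esym3_def algebra_simps)
next
  case N6 show ?thesis unfolding N6
    by (rule baecklund_params[OF bt_s.simps(7)])
      (simp_all add: admissible_def hamiltonian_ham esym1_def esym2_def esym3_def algebra_simps)
next
  case N7 show ?thesis unfolding N7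
    by (rule baecklund_params[OF bt_s.simps(8)])
      (simp_all add: admissible_def hamiltonian_ham esym1_def esym2_def esym3_def algebra_simps)
qed

lemma baecklund_word: "baecklund (word_bt u)"
proof (induction u rule: word_bt.induct)
  case 1
  show ?case using baecklund_Some by simp
next
  case (2 g e u)
  have "baecklund (bt g)" "baecklund (pinv (bt g))"
    using baecklund_s baecklund_pi baecklund_pi_inv by (cases g; simp add: pinv_bt_s pinv_bt_pi)+
  then show ?case using 2 baecklund_comp by auto
qed

section \<open>Presented groups\<close>

lemma word_eq_append:
  assumes "word_eq R u v"
  shows "word_eq R (x @ u @ y) (x @ v @ y)"
  using assms
proof induction
  case (cancel u g e v)
  then show ?case using word_eq.cancel[of R "x @ u" g e "v @ y"] by simp
next
  case (relator r u v)
  then show ?case using word_eq.relator[of r R "x @ u" "v @ y"] by simp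
qed (auto intro: word_eq.intros)

lemma word_eq_append2:
  assumes "word_eq R u u'" "word_eq R v v'"
  shows "word_eq R (u @ v) (u' @ v')"
  using word_eq_append[OF assms(1), of "[]" v] word_eq_append[OF assms(2), of u' "[]"]
  by (auto intro: word_eq.trans)

definition word_inv :: "'g word \<Rightarrow> 'g word" where
  "word_inv u = rev (map (\<lambda>(g, e). (g, \<not> e)) u)"

lemma word_inv_inv [simp]: "word_inv (word_inv u) = u"
  by (simp add: word_inv_def rev_map comp_def case_prod_beta)

lemma word_inv_left: "word_eq R (word_inv u @ u) []"
proof (induction u)
  case Nil
  then show ?case by (simp add: word_inv_def word_eq.refl)
next
  case (Cons l u)
  obtain g e where l: "l = (g, e)" by force
  have "word_eq R (word_inv (l # u) @ l # u) (word_inv u @ u)"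
    using word_eq.cancel[of R "word_inv u" g "\<not> e" u] by (simp add: word_inv_def l)
  then show ?case using Cons word_eq.trans by blast
qed

lemma word_inv_right: "word_eq R (u @ word_inv u) []"
  using word_inv_left[of R "word_inv u"] by simp

lemma word_eqI:
  assumes "word_eq R (word_inv v @ u) []"
  shows "word_eq R u v"
proof -
  have "word_eq R (v @ word_inv v @ u) v"
    using word_eq_append[OF assms, of v "[]"] by simp
  moreover have "word_eq R (v @ word_inv v @ u) u"
    using word_eq_append[OF word_inv_right, of R "[]" v u] by simp
  ultimately show ?thesis by (meson word_eq.sym word_eq.trans)
qed

lemma word_class_eq_iff: "word_class R u = word_class R v \<longleftrightarrow> word_eq R u v"
  by (auto simp: word_class_def set_eq_iff intro: word_eq.intros)

text \<open>The first isomorphism theorem at the level of words: \<open>h\<close> is multiplicative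
  and identifies exactly the equivalent words. The union defining the product of two classes
  collapses to one class, because all products of representatives have the same image under
  \<open>h\<close>.\<close>

lemma presented_group_iso:
  assumes range: "range h = carrier G"
    and mult: "\<And>u v. h (u @ v) = h u \<otimes>\<^bsub>G\<^esub> h v"
    and eq: "\<And>u v. word_eq R u v \<longleftrightarrow> h u = h v"
  shows "\<exists>\<phi> \<in> iso (presented_group R) G. \<forall>u. \<phi> (word_class R u) = h u"
proof
  define \<phi> where "\<phi> = (\<lambda>A. h (SOME u. u \<in> A))"
  have \<phi>: "\<phi> (word_class R u) = h u" for u
  proof -
    have "u \<in> word_class R u" by (simp add: word_class_def word_eq.refl)
    then have "(SOME v. v \<in> word_class R u) \<in> word_class R u" by (rule someI)
    then show ?thesis using eq by (simp add: \<phi>_def word_class_def)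
  qed
  then show "\<forall>u. \<phi> (word_class R u) = h u" by blast
  have m: "word_class R u \<otimes>\<^bsub>presented_group R\<^esub> word_class R v = word_class R (u @ v)" for u v
  proof -
    have "word_class R (u' @ v') = word_class R (u @ v)"
      if "u' \<in> word_class R u" "v' \<in> word_class R v" for u' v'
      using that by (simp add: word_class_eq_iff) (simp add: word_class_def eq mult)
    moreover have "u \<in> word_class R u" "v \<in> word_class R v"
      by (simp_all add: word_class_def word_eq.refl)
    ultimately have "(\<Union>u'\<in>word_class R u. \<Union>v'\<in>word_class R v. word_class R (u' @ v')) = word_class R (u @ v)"
      by blast
    then show ?thesis by (simp add: presented_group_def)
  qed
  show "\<phi> \<in> iso (presented_group R) G"
    unfolding iso_def
  proof (intro CollectI conjI homI bij_betw_imageI)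
    show "\<phi> x \<in> carrier G" if "x \<in> carrier (presented_group R)" for x
      using that range \<phi> by (auto simp: presented_group_def)
    show "\<phi> (x \<otimes>\<^bsub>presented_group R\<^esub> y) = \<phi> x \<otimes>\<^bsub>G\<^esub> \<phi> y"
      if "x \<in> carrier (presented_group R)" "y \<in> carrier (presented_group R)" for x y
    proof -
      from that obtain u v where "x = word_class R u" "y = word_class R v"
        by (auto simp: presented_group_def)
      then show ?thesis by (simp add: m \<phi> mult)
    qed
    show "inj_on \<phi> (carrier (presented_group R))"
      by (auto simp: inj_on_def presented_group_def \<phi> eq[symmetric] word_class_eq_iff)
    show "\<phi> ` carrier (presented_group R) = carrier G"
      unfolding range[symmetric] by (auto simp: presented_group_def \<phi> image_iff)
  qed
qed

section \<open>Faithfulness of the reflection representation\<close>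

text \<open>The reflection representation on the coroot lattice: \<open>c\<close> lists coordinates in
  the basis of simple coroots, and \<open>cartan c\<close> the values of the simple roots on \<open>c\<close>.\<close>

definition cartan :: "(node \<Rightarrow> int) \<Rightarrow> node \<Rightarrow> int" where
  "cartan c i = 2 * c i - (\<Sum>j | adjacent i j. c j)"

definition reflection :: "node \<Rightarrow> (node \<Rightarrow> int) \<Rightarrow> (node \<Rightarrow> int)" where
  "reflection i c = c(i := c i - cartan c i)"

fun geo :: "node word \<Rightarrow> (node \<Rightarrow> int) \<Rightarrow> (node \<Rightarrow> int)" where
  "geo [] = id"
| "geo ((i, e) # u) = reflection i \<circ> geo u"

lemma geo_append: "geo (u @ v) = geo u \<circ> geo v"
  by (induction u rule: geo.induct) auto

definition coroot :: "node \<Rightarrow> node \<Rightarrow> int" where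
  "coroot i = (\<lambda>j. if j = i then 1 else 0)"

lemma adjacent_sets [simp]:
  "{j. adjacent N0 j} = {N1, N4, N7}" "{j. adjacent N1 j} = {N0, N2}"
  "{j. adjacent N2 j} = {N1, N3}" "{j. adjacent N3 j} = {N2}"
  "{j. adjacent N4 j} = {N0, N5}" "{j. adjacent N5 j} = {N4, N6}"
  "{j. adjacent N6 j} = {N5}" "{j. adjacent N7 j} = {N0}"
  by (auto simp: adjacent_def edges_def)

lemma adjacent_sym: "adjacent i j \<Longrightarrow> adjacent j i"
  by (auto simp: adjacent_def)

lemma not_adjacent_refl [simp]: "\<not> adjacent i i"
  by (auto simp: adjacent_def edges_def)

lemma finite_adjacent [simp]: "finite {j. adjacent i j}"
  by (cases i) auto

lemma cartan_simps:
  "cartan c N0 = 2 * c N0 - c N1 - c N4 - c N7" "cartan c N1 = 2 * c N1 - c N0 - c N2"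
  "cartan c N2 = 2 * c N2 - c N1 - c N3" "cartan c N3 = 2 * c N3 - c N2"
  "cartan c N4 = 2 * c N4 - c N0 - c N5" "cartan c N5 = 2 * c N5 - c N4 - c N6"
  "cartan c N6 = 2 * c N6 - c N5" "cartan c N7 = 2 * c N7 - c N0"
  by (simp_all add: cartan_def)

lemma cartan_linear: "cartan (\<lambda>j. x * c j + y * d j) i = x * cartan c i + y * cartan d i"
  by (simp add: cartan_def sum.distrib sum_distrib_left algebra_simps)

lemma reflection_linear: "reflection i (\<lambda>j. x * c j + y * d j) = (\<lambda>j. x * reflection i c j + y * reflection i d j)"
  by (auto simp: reflection_def cartan_linear algebra_simps)

lemma geo_linear: "geo u (\<lambda>j. x * c j + y * d j) = (\<lambda>j. x * geo u c j + y * geo u d j)"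
  by (induction u rule: geo.induct) (auto simp: reflection_linear)

lemma cartan_coroot: "cartan (coroot t) i = (if i = t then 2 else if adjacent i t then -1 else 0)"
  by (auto simp: cartan_def coroot_def)

lemma reflection_coroot_same: "reflection t (coroot t) = (\<lambda>j. (-1) * coroot t j + 0 * coroot t j)"
  by (auto simp: reflection_def cartan_coroot) (auto simp: coroot_def)

lemma reflection_coroot_adjacent: "adjacent i t \<Longrightarrow> reflection i (coroot t) = (\<lambda>j. 1 * coroot i j + 1 * coroot t j)"
  by (auto simp: reflection_def cartan_coroot) (auto simp: coroot_def)

lemma reflection_coroot_not_adjacent: "i \<noteq> t \<Longrightarrow> \<not> adjacent i t \<Longrightarrow> reflection i (coroot t) = coroot t"
  by (auto simp: reflection_def cartan_coroot)

section \<open>Coxeter relations on words and the length function\<close>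

abbreviation aeq :: "node word \<Rightarrow> node word \<Rightarrow> bool" where
  "aeq \<equiv> word_eq affine_relators"

lemma aeq_square: "aeq [(i, True), (i, True)] []"
  using word_eq.relator[of "[(i, True), (i, True)]" affine_relators "[]" "[]"]
  by (auto simp: affine_relators_def)

text \<open>Each generator is its own inverse, so signs of letters can be ignored.\<close>

lemma aeq_False: "aeq [(i, e)] [(i, True)]"
proof (cases e)
  case False
  have "aeq [(i, False), (i, True), (i, True)] [(i, False)]"
    using word_eq_append[OF aeq_square, of "[(i, False)]" i "[]"] by simp
  moreover have "aeq [(i, False), (i, True), (i, True)] [(i, True)]"
    using word_eq.cancel[of affine_relators "[]" i False "[(i, True)]"] by simp
  ultimately show ?thesis using False word_eq.trans[OF word_eq.sym] by simp
qed (simp add: word_eq.refl)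

lemma aeq_letters: "aeq [(i, e), (i, e')] []"
  using word_eq_append2[OF aeq_False[of i e] aeq_False[of i e']] aeq_square[of i]
  by (auto intro: word_eq.trans)

lemma aeq_commute:
  assumes "i \<noteq> j" "\<not> adjacent i j"
  shows "aeq [(i, True), (j, True)] [(j, True), (i, True)]"
proof -
  have "[(i, True), (j, True), (i, True), (j, True)] \<in> affine_relators"
    using assms by (auto simp: affine_relators_def numeral_eq_Suc)
  from word_eq.relator[OF this, of "[]" "[(j, True), (i, True)]"]
  have "aeq [(i, True), (j, True), (i, True), (j, True), (j, True), (i, True)] [(j, True), (i, True)]"
    by simp
  moreover have "aeq [(i, True), (j, True), (i, True), (j, True), (j, True), (i, True)]
      [(i, True), (j, True), (i, True), (i, True)]"
    using word_eq_append[OF aeq_square[of j], of "[(i, True), (j, True), (i, True)]" "[(i, True)]"] by simp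
  moreover have "aeq [(i, True), (j, True), (i, True), (i, True)] [(i, True), (j, True)]"
    using word_eq_append[OF aeq_square[of i], of "[(i, True), (j, True)]" "[]"] by simp
  ultimately show ?thesis by (meson word_eq.sym word_eq.trans)
qed

lemma aeq_braid:
  assumes "adjacent i j"
  shows "aeq [(i, True), (j, True), (i, True)] [(j, True), (i, True), (j, True)]"
proof (rule word_eqI)
  have "[(i, True), (j, True), (i, True), (j, True), (i, True), (j, True)] \<in> affine_relators"
    using assms by (auto simp: affine_relators_def numeral_eq_Suc)
  then have r: "[(j, True), (i, True), (j, True), (i, True), (j, True), (i, True)] \<in> affine_relators"
    using assms adjacent_sym[OF assms] by (auto simp: affine_relators_def numeral_eq_Suc)
  have "aeq ([(j, False)] @ [(i, False)] @ [(j, False)] @ [(i, True), (j, True), (i, True)])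
    ([(j, True)] @ [(i, True)] @ [(j, True)] @ [(i, True), (j, True), (i, True)])"
    by (intro word_eq_append2 aeq_False word_eq.refl)
  then show "aeq (word_inv [(j, True), (i, True), (j, True)] @ [(i, True), (j, True), (i, True)]) []"
    using word_eq.relator[OF r, of "[]" "[]"] by (auto simp: word_inv_def intro: word_eq.trans)
qed

text \<open>The Coxeter length. Inverse letters among the representatives do not lower the minimum,
  since by \<open>aeq_False\<close> each can be replaced by a positive letter.\<close>

definition len :: "node word \<Rightarrow> nat" where
  "len u = (LEAST n. \<exists>v. aeq u v \<and> length v = n)"

lemma len_attained: "\<exists>v. aeq u v \<and> length v = len u"
  unfolding len_def by (rule LeastI_ex) (auto intro: word_eq.refl)

lemma len_le: "aeq u v \<Longrightarrow> len u \<le> length v"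
  unfolding len_def by (rule Least_le) auto

lemma len_cong: "aeq u v \<Longrightarrow> len u = len v"
  by (metis (mono_tags, opaque_lifting) antisym len_attained len_le word_eq.sym word_eq.trans)

lemma len_append: "len (u @ v) \<le> len u + length v"
proof -
  obtain u' where "aeq u u'" "length u' = len u" using len_attained by blast
  then show ?thesis
    using len_le[OF word_eq_append2[OF \<open>aeq u u'\<close> word_eq.refl[of _ v]]] by simp
qed

lemma aeq_snoc_snoc: "aeq (u @ [(s, True), (s, True)]) u"
  using word_eq_append[OF aeq_square[of s], of u "[]"] by simp

lemma len_snoc_snoc: "len (u @ [(s, True), (s, True)]) = len u"
  by (rule len_cong[OF aeq_snoc_snoc])

lemma aeq_geo: "aeq u v \<Longrightarrow> geo u = geo v"
proof (induction rule: word_eq.induct)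
  case (cancel u g e v)
  have "reflection g (reflection g c) = c" for c
    by (cases g) (auto simp: reflection_def cartan_simps fun_eq_iff)
  then show ?case by (simp add: geo_append comp_def)
next
  case (relator r u v)
  have "geo r = id"
    using relator unfolding affine_relators_def
  proof (elim UnE CollectE exE conjE)
    fix i assume "r = [(i, True), (i, True)]"
    then show ?thesis by (cases i) (auto simp: reflection_def cartan_simps fun_eq_iff)
  next
    fix i j assume "r = concat (replicate 3 [(i, True), (j, True)])" "adjacent i j"
    then show ?thesis
      by (cases i; cases j)
        (auto simp: adjacent_def edges_def numeral_eq_Suc reflection_def cartan_simps intro!: ext)
  next
    fix i j assume "r = concat (replicate 2 [(i, True), (j, True)])" "i \<noteq> j" "\<not> adjacent i j"
    then show ?thesis
      by (cases i; cases j)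
        (auto simp: adjacent_def edges_def numeral_eq_Suc reflection_def cartan_simps intro!: ext)
  qed
  then show ?case by (simp add: geo_append)
qed auto

text \<open>The last letter of a shortest representative is a right descent.\<close>

lemma reduced_snoc:
  assumes "len w \<noteq> 0"
  obtains t where "len (w @ [(t, True)]) < len w"
proof -
  obtain v where v: "aeq w v" "length v = len w" using len_attained by blast
  then obtain v' t e where v': "v = v' @ [(t, e)]"
    using assms by (cases v rule: rev_cases) auto
  have "aeq (w @ [(t, True)]) (v' @ [(t, e), (t, True)])"
    using word_eq_append[OF v(1), of "[]" "[(t, True)]"] v' by simp
  moreover have "aeq (v' @ [(t, e), (t, True)]) v'"
    using word_eq_append[OF aeq_letters[of t e True], of v' "[]"] by simp
  ultimately have "len (w @ [(t, True)]) \<le> length v'" using len_le word_eq.trans by blast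
  then have "len (w @ [(t, True)]) < len w" using v(2) v' by simp
  then show thesis using that by blast
qed

text \<open>Tits' theorem.  Since all bonds are simple, the usual reduction to dihedral subgroups
  amounts to stripping at most two letters.\<close>

lemma geo_coroot_nonneg:
  assumes "len w \<le> len (w @ [(s, True)])"
  shows "0 \<le> geo w (coroot s) k"
  using assms
proof (induction "len w" arbitrary: w s k rule: less_induct)
  case less
  show ?case
  proof (cases "len w = 0")
    case True
    then obtain v where "aeq w v" "v = []" using len_attained[of w] by auto
    then have "geo w = id" using aeq_geo by fastforce
    then show ?thesis by (simp add: coroot_def)
  next
    case False
    then obtain t where t: "len (w @ [(t, True)]) < len w" using reduced_snoc by blast
    define v where "v = w @ [(t, True)]"
    have lv: "len v < len w" using t v_def by simp
    have wv: "aeq w (v @ [(t, True)])"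
      using aeq_snoc_snoc[of w t] by (simp add: v_def word_eq.sym)
    then have geo_w: "geo w = geo v \<circ> reflection t" using aeq_geo by (fastforce simp: geo_append)
    have lvt: "len (v @ [(t, True)]) = len w" using len_cong[OF wv] by simp
    have ts: "t \<noteq> s" using t less.prems by auto
    have ws: "aeq (w @ [(s, True)]) (v @ [(t, True), (s, True)])"
      using word_eq_append[OF wv, of "[]" "[(s, True)]"] by simp
    have lw: "len w \<le> Suc (len v)" using len_append[of v "[(t, True)]"] lvt by simp
    show ?thesis
    proof (cases "adjacent t s")
      case False
      \<comment> \<open>Here \<open>t\<close> fixes the coroot of \<open>s\<close>, so the claim
        passes to \<open>v\<close> and \<open>s\<close>. If \<open>s\<close> shortened
        \<open>v\<close>, commuting the last two letters would write \<open>w s\<close> as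
        \<open>v s t\<close>, of length at most \<open>len v\<close>, which is below
        \<open>len w\<close>.\<close>
      have "len v \<le> len (v @ [(s, True)])"
      proof (rule ccontr)
        assume "\<not> ?thesis"
        then have "len (v @ [(s, True), (t, True)]) \<le> len v"
          using len_append[of "v @ [(s, True)]" "[(t, True)]"] by simp
        moreover have "aeq (w @ [(s, True)]) (v @ [(s, True), (t, True)])"
          using word_eq.trans[OF ws] word_eq_append[OF aeq_commute[OF ts False], of v "[]"] by simp
        ultimately show False using len_cong less.prems lv by fastforce
      qed
      then have "0 \<le> geo v (coroot s) k" using less.hyps[OF lv] by blast
      then show ?thesis using reflection_coroot_not_adjacent[OF ts False] geo_w by simp
    next
      case True
      show ?thesis
      proof (cases "len v \<le> len (v @ [(s, True)])")
        case le: True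
        \<comment> \<open>Here \<open>t\<close> sends the coroot of \<open>s\<close> to the sum of
          the two coroots, and neither \<open>s\<close> nor \<open>t\<close> shortens
          \<open>v\<close>.\<close>
        have "0 \<le> geo v (coroot s) k" using less.hyps[OF lv le] .
        moreover have "0 \<le> geo v (coroot t) k" using less.hyps[OF lv] lvt lv by simp
        ultimately show ?thesis
          using reflection_coroot_adjacent[OF True] geo_w geo_linear[of v 1 "coroot t" 1 "coroot s"] by simp
      next
        case lt: False
        \<comment> \<open>Now \<open>w\<close> is \<open>v' s t\<close>, and \<open>s t\<close> maps
          the coroot of \<open>s\<close> to that of \<open>t\<close>, so the claim passes to
          \<open>v'\<close> and \<open>t\<close>. If \<open>t\<close> shortened \<open>v'\<close>,
          the braid relation would turn \<open>w s = v' s t s\<close> into \<open>v' t s t\<close>,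
          of length at most \<open>len v' + 1\<close>, again below \<open>len w\<close>.\<close>
        define v' where "v' = v @ [(s, True)]"
        have lv': "len v' < len v" using lt by (simp add: v'_def)
        have vv': "aeq v (v' @ [(s, True)])"
          using aeq_snoc_snoc[of v s] by (simp add: v'_def word_eq.sym)
        have "len v' \<le> len (v' @ [(t, True)])"
        proof (rule ccontr)
          assume "\<not> ?thesis"
          then have "len (v' @ [(t, True), (s, True), (t, True)]) \<le> Suc (len v')"
            using len_append[of "v' @ [(t, True)]" "[(s, True), (t, True)]"] by simp
          moreover have "aeq (w @ [(s, True)]) (v' @ [(t, True), (s, True), (t, True)])"
          proof -
            have "aeq (v @ [(t, True), (s, True)]) (v' @ [(s, True), (t, True), (s, True)])"
              using word_eq_append[OF vv', of "[]" "[(t, True), (s, True)]"] by simp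
            moreover have "aeq (v' @ [(s, True), (t, True), (s, True)]) (v' @ [(t, True), (s, True), (t, True)])"
              using word_eq_append[OF aeq_braid[OF adjacent_sym[OF True]], of v' "[]"] by simp
            ultimately show ?thesis using ws by (meson word_eq.trans)
          qed
          ultimately show False using len_cong less.prems lv lv' by fastforce
        qed
        then have "0 \<le> geo v' (coroot t) k" using less.hyps lv lv' by simp
        moreover have "geo w (coroot s) = geo v' (coroot t)"
        proof -
          have "reflection s (reflection t (coroot s)) = coroot t"
            using True adjacent_sym[OF True] ts
            by (cases s; cases t) (auto simp: adjacent_def edges_def reflection_def cartan_simps coroot_def)
          moreover have "geo v = geo v' \<circ> reflection s" using aeq_geo[OF vv'] by (simp add: geo_append)
          ultimately show ?thesis using geo_w by simp
        qed
        ultimately show ?thesis by simp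
      qed
    qed
  qed
qed

text \<open>A word of positive length has a right descent \<open>t\<close>. Since \<open>t\<close>
  lengthens \<open>w t\<close>, this word maps the coroot of \<open>t\<close> to a nonnegative
  vector; but if \<open>w\<close> acts trivially, the image is minus that coroot.\<close>

lemma geo_faithful:
  assumes "\<And>c. geo w c = c"
  shows "aeq w []"
proof (cases "len w = 0")
  case True
  then show ?thesis using len_attained[of w] by auto
next
  case False
  then obtain t where t: "len (w @ [(t, True)]) < len w" using reduced_snoc by blast
  have "len (w @ [(t, True)] @ [(t, True)]) = len w" using len_snoc_snoc by simp
  then have "0 \<le> geo (w @ [(t, True)]) (coroot t) t" using t geo_coroot_nonneg by simp
  moreover have "geo (w @ [(t, True)]) (coroot t) t = - 1"
    using assms by (simp add: geo_append reflection_coroot_same) (simp add: coroot_def)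
  ultimately show ?thesis by simp
qed

section \<open>Perturbation of the zero parameter\<close>

text \<open>Rational functions regular at 0, constrained only off the zeros of some denominator.
  This tolerates the finitely many arguments at which division by zero makes the HOL value
  meaningless, and no reduced fractions are required.\<close>

definition ratfun :: "(complex \<Rightarrow> complex) \<Rightarrow> bool" where
  "ratfun f \<longleftrightarrow> (\<exists>N D. poly D 0 \<noteq> 0 \<and> (\<forall>x. poly D x \<noteq> 0 \<longrightarrow> f x = poly N x / poly D x))"

lemma ratfunI:
  assumes "poly D 0 \<noteq> 0" "\<And>x. poly D x \<noteq> 0 \<Longrightarrow> f x = poly N x / poly D x"
  shows "ratfun f"
  using assms by (auto simp: ratfun_def)

lemma ratfun_const: "ratfun (\<lambda>_. c)"
  by (rule ratfunI[of 1 _ "[:c:]"]) auto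

lemma ratfun_ident: "ratfun (\<lambda>x. x)"
  by (rule ratfunI[of 1 _ "[:0, 1:]"]) auto

lemma ratfun_add:
  assumes "ratfun f" "ratfun g"
  shows "ratfun (\<lambda>x. f x + g x)"
proof -
  obtain N D where f: "poly D 0 \<noteq> 0" "\<And>x. poly D x \<noteq> 0 \<Longrightarrow> f x = poly N x / poly D x"
    using assms(1) by (auto simp: ratfun_def)
  obtain N' D' where g: "poly D' 0 \<noteq> 0" "\<And>x. poly D' x \<noteq> 0 \<Longrightarrow> g x = poly N' x / poly D' x"
    using assms(2) by (auto simp: ratfun_def)
  show ?thesis
    by (rule ratfunI[of "D * D'" _ "N * D' + N' * D"]) (use f g in \<open>auto simp: field_simps\<close>)
qed

lemma ratfun_mult:
  assumes "ratfun f" "ratfun g"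
  shows "ratfun (\<lambda>x. f x * g x)"
proof -
  obtain N D where f: "poly D 0 \<noteq> 0" "\<And>x. poly D x \<noteq> 0 \<Longrightarrow> f x = poly N x / poly D x"
    using assms(1) by (auto simp: ratfun_def)
  obtain N' D' where g: "poly D' 0 \<noteq> 0" "\<And>x. poly D' x \<noteq> 0 \<Longrightarrow> g x = poly N' x / poly D' x"
    using assms(2) by (auto simp: ratfun_def)
  show ?thesis
    by (rule ratfunI[of "D * D'" _ "N * N'"]) (use f g in auto)
qed

lemma ratfun_inverse:
  assumes "ratfun f" "f 0 \<noteq> 0"
  shows "ratfun (\<lambda>x. inverse (f x))"
proof -
  obtain N D where f: "poly D 0 \<noteq> 0" "\<And>x. poly D x \<noteq> 0 \<Longrightarrow> f x = poly N x / poly D x"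
    using assms(1) by (auto simp: ratfun_def)
  show ?thesis
    by (rule ratfunI[of "D * N" _ "D * D"]) (use f assms(2) in auto)
qed

lemma ratfun_uminus: "ratfun f \<Longrightarrow> ratfun (\<lambda>x. - f x)"
  using ratfun_mult[OF ratfun_const[of "-1"]] by simp

lemma ratfun_diff: "ratfun f \<Longrightarrow> ratfun g \<Longrightarrow> ratfun (\<lambda>x. f x - g x)"
  using ratfun_add[OF _ ratfun_uminus[of g]] by simp

lemma ratfun_divide: "ratfun f \<Longrightarrow> ratfun g \<Longrightarrow> g 0 \<noteq> 0 \<Longrightarrow> ratfun (\<lambda>x. f x / g x)"
  using ratfun_mult[OF _ ratfun_inverse[of g]] by (simp add: field_simps)

lemmas ratfun_intros = ratfun_const ratfun_ident ratfun_add ratfun_mult ratfun_uminus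
  ratfun_diff ratfun_divide

lemma ratfun_finite_zeros:
  assumes "ratfun f" "f 0 \<noteq> 0"
  shows "finite {x. f x = 0}"
proof -
  obtain N D where f: "poly D 0 \<noteq> 0" "\<And>x. poly D x \<noteq> 0 \<Longrightarrow> f x = poly N x / poly D x"
    using assms(1) by (auto simp: ratfun_def)
  have "N \<noteq> 0" "D \<noteq> 0" using f assms(2) by auto
  then have "finite ({x. poly N x = 0} \<union> {x. poly D x = 0})" using poly_roots_finite by blast
  then show ?thesis by (rule rev_finite_subset) (use f in auto)
qed

lemma ratfun_differentiable:
  assumes "ratfun f"
  obtains f' where "(f has_field_derivative f') (at 0)"
proof -
  obtain N D where f: "poly D 0 \<noteq> 0" "\<And>x. poly D x \<noteq> 0 \<Longrightarrow> f x = poly N x / poly D x"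
    using assms(1) by (auto simp: ratfun_def)
  have "isCont (poly D) 0" by simp
  then have "\<forall>\<^sub>F x in nhds 0. poly D x \<noteq> 0"
    using f(1) by (intro tendsto_imp_eventually_ne[of "poly D"]) (auto simp: continuous_at tendsto_at_iff_tendsto_nhds)
  then have "\<forall>\<^sub>F x in nhds 0. f x = poly N x / poly D x" by (rule eventually_mono) (use f in auto)
  moreover have "((\<lambda>x. poly N x / poly D x) has_field_derivative
     (poly (pderiv N) 0 * poly D 0 - poly N 0 * poly (pderiv D) 0) / (poly D 0 * poly D 0)) (at 0)"
    by (intro DERIV_divide poly_DERIV f)
  ultimately show thesis using that DERIV_cong_ev[OF HOL.refl _ HOL.refl, of f "\<lambda>x. poly N x / poly D x" 0] by blast
qed

text \<open>A line of parameters through 0 in the direction of the simple root values on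
  \<open>c\<close>. It stays in the hyperplane because the coefficients of \<open>admissible\<close>
  are those of the null root, which annihilate the Cartan matrix.\<close>

definition cparams :: "(node \<Rightarrow> int) \<Rightarrow> complex \<Rightarrow> params" where
  "cparams c x = (\<lambda>j. x * of_int (cartan c j))"

lemma admissible_cparams: "admissible (cparams c x)"
  by (simp add: admissible_def cparams_def cartan_simps algebra_simps)

lemma cparams_aut: "cparams c x \<circ> diagram_aut = cparams (c \<circ> diagram_aut) x"
  by (rule params_eqI) (simp_all add: cparams_def cartan_simps)

text \<open>To first order in \<open>x\<close> the Weyl group acts on \<open>q\<close>, \<open>p\<close> and the parameters \<open>cparams c x\<close>
  as it does on the coroot lattice: the \<open>N0\<close>-coordinate of \<open>c\<close>, which the parameters only
  determine up to the null vector, is recovered from the derivative of \<open>q\<close>.\<close>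

lemma bt_s_curve:
  assumes "ratfun q" "ratfun p" "q 0 \<noteq> 0" "q 0 \<noteq> 1" "p 0 \<noteq> 0"
  obtains q' p' F where "finite F" "ratfun q'" "ratfun p'" "q' 0 = q 0" "p' 0 = p 0"
    "\<And>x. x \<notin> F \<Longrightarrow> bt_s i (q x, p x, t, cparams c x) = Some (q' x, p' x, t, cparams (reflection i c) x)"
    "\<And>d. (q has_field_derivative d) (at 0) \<Longrightarrow>
      (q' has_field_derivative d + of_int (c N0 - reflection i c N0) / p 0) (at 0)"
proof -
  have par: "(cparams c x)(N0 := - cparams c x N0, N1 := cparams c x N1 + cparams c x N0,
        N4 := cparams c x N4 + cparams c x N0, N7 := cparams c x N7 + cparams c x N0) = cparams (reflection N0 c) x"
    "(cparams c x)(N0 := cparams c x N0 + cparams c x N1, N1 := - cparams c x N1, N2 := cparams c x N2 + cparams c x N1)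
      = cparams (reflection N1 c) x"
    "(cparams c x)(N0 := cparams c x N0 + cparams c x N4, N4 := - cparams c x N4, N5 := cparams c x N5 + cparams c x N4)
      = cparams (reflection N4 c) x" for x
    by (rule params_eqI; simp add: cparams_def cartan_simps reflection_def algebra_simps)+
  consider "i = N0" | "i = N1" | "i = N4" | "i \<notin> {N0, N1, N4}" by blast
  then show thesis
  proof cases
    case 1
    let ?q = "\<lambda>x. q x + x * of_int (cartan c N0) / p x"
    show ?thesis
    proof (rule that[of "{x. p x = 0}" ?q p])
      show "finite {x. p x = 0}" using assms ratfun_finite_zeros by blast
      show "ratfun ?q" using assms by (intro ratfun_intros)
      fix x assume "x \<notin> {x. p x = 0}"
      then show "bt_s i (q x, p x, t, cparams c x) = Some (?q x, p x, t, cparams (reflection i c) x)"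
        using par(1)[of x] unfolding 1 by (simp add: cparams_def[of c x])
    next
      fix d assume d: "(q has_field_derivative d) (at 0)"
      obtain p' where p': "(p has_field_derivative p') (at 0)" using ratfun_differentiable assms(2) by blast
      \<comment> \<open>The factor \<open>x\<close> vanishes at 0, so \<open>p'\<close> does not
        enter the derivative.\<close>
      have "((\<lambda>x. x * of_int (cartan c N0) / p x) has_field_derivative of_int (cartan c N0) / p 0) (at 0)"
        by (rule derivative_eq_intros p' HOL.refl)+ (use assms(5) in \<open>simp_all add: field_simps\<close>)
      from DERIV_add[OF d this]
      show "(?q has_field_derivative d + of_int (c N0 - reflection i c N0) / p 0) (at 0)"
        by (simp add: 1 reflection_def)
    qed (use assms in auto)
  next
    case 2
    let ?p = "\<lambda>x. p x - x * of_int (cartan c N1) / q x"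
    show ?thesis
    proof (rule that[of "{x. q x = 0}" q ?p])
      show "finite {x. q x = 0}" using assms ratfun_finite_zeros by blast
      show "ratfun ?p" using assms by (intro ratfun_intros)
      fix x assume "x \<notin> {x. q x = 0}"
      then show "bt_s i (q x, p x, t, cparams c x) = Some (q x, ?p x, t, cparams (reflection i c) x)"
        using par(2)[of x] unfolding 2 by (simp add: cparams_def[of c x])
    qed (use assms in \<open>auto simp: 2 reflection_def\<close>)
  next
    case 3
    let ?p = "\<lambda>x. p x - x * of_int (cartan c N4) / (q x - 1)"
    have q1: "ratfun (\<lambda>x. q x - 1)" "q 0 - 1 \<noteq> 0" using assms by (auto intro: ratfun_intros)
    show ?thesis
    proof (rule that[of "{x. q x - 1 = 0}" q ?p])
      show "finite {x. q x - 1 = 0}" using q1 ratfun_finite_zeros by blast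
      show "ratfun ?p" using assms q1 by (intro ratfun_intros)
      fix x assume "x \<notin> {x. q x - 1 = 0}"
      then show "bt_s i (q x, p x, t, cparams c x) = Some (q x, ?p x, t, cparams (reflection i c) x)"
        using par(3)[of x] unfolding 3 by (simp add: cparams_def[of c x])
    qed (use assms in \<open>auto simp: 3 reflection_def\<close>)
  next
    case 4
    have "bt_s i (q x, p x, t, cparams c x) = Some (q x, p x, t, cparams (reflection i c) x)" for x
      using 4 by (cases i) (auto intro!: params_eqI simp: cparams_def cartan_simps reflection_def algebra_simps)
    then show ?thesis
      using assms 4 by (intro that[of "{}" q p]) (auto simp: reflection_def)
  qed
qed

text \<open>The induction is carried by the values at \<open>x = 0\<close>: there reflections leave
  \<open>q\<close> and \<open>p\<close> alone, while \<open>Pi\<close> and its inverse give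
  \<open>1 - q\<close> and \<open>- p\<close>, so \<open>q\<close> avoids 0 and 1 and
  \<open>p\<close> avoids 0. Hence every denominator met is a rational function that does not vanish
  identically.\<close>

lemma word_bt_curve:
  assumes "q \<noteq> 0" "q \<noteq> 1" "p \<noteq> 0"
  shows "\<exists>F Q P t' c'. finite F \<and> ratfun Q \<and> ratfun P \<and> Q 0 \<noteq> 0 \<and> Q 0 \<noteq> 1 \<and> P 0 \<noteq> 0 \<and>
    (\<forall>x. x \<notin> F \<longrightarrow> word_bt u (q, p, t, cparams c x) = Some (Q x, P x, t', cparams c' x))"
proof (induction u rule: word_bt.induct)
  case 1
  show ?case
    by (rule exI[of _ "{}"], rule exI[of _ "\<lambda>_. q"], rule exI[of _ "\<lambda>_. p"], rule exI[of _ t], rule exI[of _ c])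
      (use assms in \<open>auto intro: ratfun_const\<close>)
next
  case (2 g e u)
  then obtain F Q P t' c' where *: "finite F" "ratfun Q" "ratfun P" "Q 0 \<noteq> 0" "Q 0 \<noteq> 1" "P 0 \<noteq> 0"
    "\<And>x. x \<notin> F \<Longrightarrow> word_bt u (q, p, t, cparams c x) = Some (Q x, P x, t', cparams c' x)" by blast
  show ?case
  proof (cases g)
    case (S i)
    obtain Q' P' F' where **: "finite F'" "ratfun Q'" "ratfun P'" "Q' 0 = Q 0" "P' 0 = P 0"
      "\<And>x. x \<notin> F' \<Longrightarrow> bt_s i (Q x, P x, t', cparams c' x) = Some (Q' x, P' x, t', cparams (reflection i c') x)"
      using bt_s_curve[OF *(2-6)] by metis
    have "\<forall>x. x \<notin> F \<union> F' \<longrightarrow> word_bt ((g, e) # u) (q, p, t, cparams c x) = Some (Q' x, P' x, t', cparams (reflection i c') x)"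
      using * ** by (simp add: S pinv_bt_s)
    moreover have "finite (F \<union> F')" using * ** by simp
    ultimately show ?thesis using * ** by metis
  next
    case Pi
    define t'' where "t'' = (if e then t' + 1 else t' - 1)"
    define Q' where "Q' = (\<lambda>x. 1 - Q x)"
    define P' where "P' = (\<lambda>x. - P x)"
    define c'' where "c'' = c' \<circ> diagram_aut"
    have "word_bt ((g, e) # u) (q, p, t, cparams c x) = Some (Q' x, P' x, t'', cparams c'' x)" if "x \<notin> F" for x
      using * that
      by (simp add: Pi pinv_bt_pi bt_pi_inv_def permute_pi cparams_aut t''_def Q'_def P'_def c''_def del: bt_pi.simps)
        (simp add: permute_pi cparams_aut)
    moreover have "ratfun Q'" "ratfun P'"
      using * by (auto intro: ratfun_intros simp: Q'_def P'_def)
    moreover have "Q' 0 \<noteq> 0" "Q' 0 \<noteq> 1" "P' 0 \<noteq> 0" using * by (auto simp: Q'_def P'_def)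
    ultimately show ?thesis using *(1) by blast
  qed
qed

abbreviation embed :: "node word \<Rightarrow> gen word" where
  "embed \<equiv> map (map_prod S id)"

text \<open>Each letter contributes its change of the \<open>N0\<close>-coordinate divided by
  \<open>p\<close>, and these contributions telescope. The divisor is always the initial
  \<open>p\<close>, since \<open>P 0\<close> never changes.\<close>

lemma word_bt_embed_curve:
  assumes "q \<noteq> 0" "q \<noteq> 1" "p \<noteq> 0"
  shows "\<exists>F Q P. finite F \<and> ratfun Q \<and> ratfun P \<and> Q 0 = q \<and> P 0 = p \<and>
    (Q has_field_derivative of_int (c N0 - geo u c N0) / p) (at 0) \<and>
    (\<forall>x. x \<notin> F \<longrightarrow> word_bt (embed u) (q, p, t, cparams c x) = Some (Q x, P x, t, cparams (geo u c) x))"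
proof (induction u rule: geo.induct)
  case 1
  show ?case
    by (rule exI[of _ "{}"], rule exI[of _ "\<lambda>_. q"], rule exI[of _ "\<lambda>_. p"])
      (use assms in \<open>auto intro: ratfun_const\<close>)
next
  case (2 i e u)
  then obtain F Q P where *: "finite F" "ratfun Q" "ratfun P" "Q 0 = q" "P 0 = p"
    "(Q has_field_derivative of_int (c N0 - geo u c N0) / p) (at 0)"
    "\<And>x. x \<notin> F \<Longrightarrow> word_bt (embed u) (q, p, t, cparams c x) = Some (Q x, P x, t, cparams (geo u c) x)" by blast
  have "Q 0 \<noteq> 0" "Q 0 \<noteq> 1" "P 0 \<noteq> 0" using * assms by auto
  from bt_s_curve[OF *(2,3) this, where i = i and t = t and c = "geo u c"]
  obtain Q' P' F' where **: "finite F'" "ratfun Q'" "ratfun P'" "Q' 0 = Q 0" "P' 0 = P 0"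
    "\<And>x. x \<notin> F' \<Longrightarrow> bt_s i (Q x, P x, t, cparams (geo u c) x) = Some (Q' x, P' x, t, cparams (reflection i (geo u c)) x)"
    "\<And>d. (Q has_field_derivative d) (at 0) \<Longrightarrow>
      (Q' has_field_derivative d + of_int (geo u c N0 - reflection i (geo u c) N0) / P 0) (at 0)"
    by metis
  have "(Q' has_field_derivative of_int (c N0 - geo ((i, e) # u) c N0) / p) (at 0)"
    using **(7)[OF *(6)] *(5) by (simp add: diff_divide_distrib)
  moreover have "\<forall>x. x \<notin> F \<union> F' \<longrightarrow> word_bt (embed ((i, e) # u)) (q, p, t, cparams c x) = Some (Q' x, P' x, t, cparams (geo ((i, e) # u) c) x)"
    using * ** by (simp add: pinv_bt_s)
  moreover have "finite (F \<union> F')" using * ** by simp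
  ultimately show ?case using * ** by metis
qed

section \<open>Regular points along a curve\<close>

lemma countable_words: "countable (UNIV :: gen word set)"
proof -
  have "x \<in> insert Pi (range S)" for x by (cases x) auto
  then have "UNIV = insert Pi (range S)" by blast
  then have "finite (UNIV :: gen set)" by (metis UNIV_node finite.emptyI finite_insert finite_imageI)
  then show ?thesis using countable_lists[OF countable_finite, of "UNIV :: (gen \<times> bool) set"] by (simp add: finite_Prod_UNIV)
qed

text \<open>Regularity asks for the domains of all words, but there are countably many words and
  each fails at finitely many \<open>x\<close>.\<close>

lemma countable_irregular:
  assumes "q \<noteq> 0" "q \<noteq> 1" "p \<noteq> 0"
  shows "countable {x. (q, p, t, cparams c x) \<notin> regular_points}"
proof -
  have "\<exists>F. \<forall>u. finite (F u) \<and> (\<forall>x. x \<notin> F u \<longrightarrow> (q, p, t, cparams c x) \<in> dom (word_bt u))"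
    using word_bt_curve[OF assms, of _ t c] by (intro choice) (metis domI)
  then obtain F where F: "\<And>u. finite (F u)" "\<And>u x. x \<notin> F u \<Longrightarrow> (q, p, t, cparams c x) \<in> dom (word_bt u)"
    by blast
  have "countable (\<Union>u. F u)" using countable_words F(1) by (simp add: countable_finite)
  then show ?thesis
    by (rule countable_subset[rotated]) (use F(2) admissible_cparams in \<open>unfold regular_points_def, blast\<close>)
qed

lemma islimpt_co_countable:
  fixes z :: complex
  assumes "countable (- A)"
  shows "z islimpt A"
  unfolding islimpt_approachable
proof (intro allI impI)
  fix e :: real assume "e > 0"
  have "\<not> ball z e \<subseteq> insert z (- A)"
    using uncountable_ball[OF \<open>e > 0\<close>, of z] countable_insert[OF assms, of z] by (metis countable_subset)
  then show "\<exists>x'\<in>A. x' \<noteq> z \<and> dist x' z < e" by (auto simp: dist_commute)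
qed

text \<open>The time coordinate \<open>d\<close> is left free so that the lemma also applies to
  words known only to be time translations. The base point \<open>q = 2\<close>,
  \<open>p = 1\<close> is a choice satisfying \<open>q\<close> outside {0, 1} and \<open>p\<close>
  nonzero.\<close>

lemma word_bt_faithful:
  assumes "\<And>q p t a. (q, p, t, a) \<in> regular_points \<Longrightarrow> \<exists>d. word_bt (embed w) (q, p, t, a) = Some (q, p, d, a)"
  shows "aeq w []"
proof (rule geo_faithful)
  fix c
  have "(2 :: complex) \<noteq> 0" "(2 :: complex) \<noteq> 1" "(1 :: complex) \<noteq> 0" by simp_all
  from word_bt_embed_curve[OF this, of c w 0]
  obtain F Q P where *: "finite F" "Q 0 = 2"
    "(Q has_field_derivative of_int (c N0 - geo w c N0) / 1) (at 0)"
    "\<And>x. x \<notin> F \<Longrightarrow> word_bt (embed w) (2, 1, 0, cparams c x) = Some (Q x, P x, 0, cparams (geo w c) x)"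
    by blast
  define A where "A = {x. (2, 1, 0, cparams c x) \<in> regular_points} - F"
  have "- A = {x. (2, 1, 0, cparams c x) \<notin> regular_points} \<union> F" by (auto simp: A_def)
  then have "countable (- A)" using countable_irregular[of 2 1 0 c] * by (simp add: countable_finite)
  then have lim: "0 islimpt A" by (rule islimpt_co_countable)
  have A: "Q x = 2" "cparams (geo w c) x = cparams c x" if "x \<in> A" for x
    using assms[of 2 1 0 "cparams c x"] *(4)[of x] that by (auto simp: A_def)
  have "((\<lambda>x. (Q x - Q 0) / (x - 0)) \<longlongrightarrow> of_int (c N0 - geo w c N0)) (at 0 within A)"
    using *(3) has_field_derivative_at_within[of Q _ 0 A] by (simp add: has_field_derivative_iff)
  moreover have "((\<lambda>x. (Q x - Q 0) / (x - 0)) \<longlongrightarrow> 0) (at 0 within A)"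
    by (rule tendsto_eventually) (use A *(2) in \<open>auto simp: eventually_at_filter\<close>)
  ultimately have "(of_int (c N0 - geo w c N0) :: complex) = 0"
    using tendsto_unique lim by (metis trivial_limit_within)
  then have c0: "geo w c N0 = c N0" by simp
  obtain x where "x \<in> A" "x \<noteq> 0" using lim by (metis islimpt_approachable zero_less_one)
  then have "cartan (geo w c) j = cartan c j" for j
    using A(2)[OF \<open>x \<in> A\<close>] by (auto simp: cparams_def fun_eq_iff)
  \<comment> \<open>Equal root values leave a difference proportional to the null vector; agreement
    at \<open>N0\<close> makes it zero.\<close>
  note this[of N0] this[of N1] this[of N2] this[of N3] this[of N4] this[of N5] this[of N6] this[of N7]
  note eqs = this[unfolded cartan_simps] c0
  show "geo w c = c"
    by (rule params_eqI) (use eqs in linarith)+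
qed

section \<open>The group acting on regular points\<close>

lemma bt_inverse: "(if e then bt g else pinv (bt g)) x = Some y \<longleftrightarrow> (if \<not> e then bt g else pinv (bt g)) y = Some x"
proof -
  have "bt g x = Some y \<longleftrightarrow> pinv (bt g) y = Some x" for x y
  proof (cases g)
    case (S i)
    then show ?thesis unfolding S bt.simps pinv_bt_s by (blast dest: bt_s_involution)
  next
    case Pi
    have "bt_pi_inv y = Some x" if "bt_pi x = Some y"
      using fun_cong[OF bt_pi_inv_pi(2), of x] that by simp
    moreover have "bt_pi x = Some y" if "bt_pi_inv y = Some x"
      using fun_cong[OF bt_pi_inv_pi(1), of y] that by simp
    ultimately show ?thesis using Pi by (auto simp: pinv_bt_pi)
  qed
  then show ?thesis by auto
qed

lemma word_bt_append: "word_bt (u @ v) = word_bt u \<circ>\<^sub>m word_bt v"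
  by (induction u rule: word_bt.induct) (simp_all add: map_comp_Some map_comp_assoc)

lemma admissible_word_bt:
  "word_bt u (q, p, t, a) = Some (q', p', t', a') \<Longrightarrow> admissible a \<Longrightarrow> admissible a'"
proof (induction u arbitrary: q' p' t' a' rule: word_bt.induct)
  case (2 g e u)
  then obtain q1 p1 t1 a1 where 1: "word_bt u (q, p, t, a) = Some (q1, p1, t1, a1)"
    "(if e then bt g else pinv (bt g)) (q1, p1, t1, a1) = Some (q', p', t', a')"
    by (auto simp: map_comp_def split: option.splits)
  then have adm: "admissible a1" using 2 by blast
  show ?case
  proof (cases g)
    case (S i)
    then show ?thesis using 1 adm
      by (cases i) (auto simp: pinv_bt_s admissible_def algebra_simps split: if_splits)
  next
    case Pi
    then show ?thesis using 1 adm
      by (auto simp: pinv_bt_pi bt_pi_inv_def admissible_def algebra_simps split: if_splits)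
  qed
qed auto

text \<open>Regular points are stable because prefixing a word \<open>v\<close> to \<open>u\<close>
  gives another word, at which the original point is already known to be defined.\<close>

lemma word_bt_regular:
  assumes "x \<in> regular_points"
  shows "\<exists>y\<in>regular_points. word_bt u x = Some y"
proof -
  obtain q p t a where x: "x = (q, p, t, a)" by (metis prod_cases4)
  then have "x \<in> dom (word_bt u)" using assms unfolding regular_points_def by blast
  then obtain y where y: "word_bt u x = Some y" by blast
  obtain q' p' t' a' where y': "y = (q', p', t', a')" by (metis prod_cases4)
  have "y \<in> dom (word_bt v)" for v
  proof -
    have "x \<in> dom (word_bt (v @ u))" using assms by (auto simp: regular_points_def x)
    then show ?thesis using y by (auto simp: word_bt_append)
  qed
  then have "y \<in> regular_points"
    using admissible_word_bt[of u q p t a] y y' x assms by (auto simp: regular_points_def)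
  then show ?thesis using y by blast
qed

definition act :: "gen word \<Rightarrow> point \<Rightarrow> point" where
  "act u = (\<lambda>x\<in>regular_points. the (word_bt u x))"

lemma act_regular:
  assumes "x \<in> regular_points"
  shows "act u x \<in> regular_points" "word_bt u x = Some (act u x)"
  using word_bt_regular[OF assms, of u] assms by (auto simp: act_def)

lemma act_eqI:
  assumes "\<And>x. x \<in> regular_points \<Longrightarrow> act u x = act v x"
  shows "act u = act v"
  using assms by (auto simp: act_def fun_eq_iff restrict_def)

lemma act_append: "x \<in> regular_points \<Longrightarrow> act (u @ v) x = act u (act v x)"
  using act_regular(2)[of x v] act_regular[of "act v x" u] act_regular(1)[of x v] act_regular(2)[of x "u @ v"]
  by (simp add: word_bt_append)

lemma act_Nil: "x \<in> regular_points \<Longrightarrow> act [] x = x"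
  by (simp add: act_def)

lemma act_cong: "act u = act v \<Longrightarrow> act (x @ u @ y) = act (x @ v @ y)"
  by (rule act_eqI) (simp add: act_append act_regular)

lemma act_cancel: "act [(g, e), (g, \<not> e)] = act []"
proof (rule act_eqI)
  fix x assume x: "x \<in> regular_points"
  obtain y where y: "word_bt [(g, \<not> e)] x = Some y" using act_regular(2)[OF x] by blast
  then have "(if e then bt g else pinv (bt g)) y = Some x" using bt_inverse[of "\<not> e" g x y] by simp
  then have "word_bt [(g, e), (g, \<not> e)] x = Some x" using y by (simp add: map_comp_def split: if_splits)
  then show "act [(g, e), (g, \<not> e)] x = act [] x" using x by (simp add: act_def)
qed

lemma act_word_eq:
  assumes "word_eq R u v" "\<And>r. r \<in> R \<Longrightarrow> act (map (map_prod f id) r) = act []"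
  shows "act (map (map_prod f id) u) = act (map (map_prod f id) v)"
  using assms(1)
proof induction
  case (cancel u g e v)
  then show ?case using act_cong[OF act_cancel, of "map (map_prod f id) u" "f g" e] by (simp add: id_def)
next
  case (relator r u v)
  then show ?case using act_cong[OF assms(2)] by fastforce
qed auto

text \<open>Equivalence for the empty set of relators is free cancellation, which every action
  respects.\<close>

lemma act_word_inv: "act (word_inv u @ u) = act []" "act (u @ word_inv u) = act []"
  using act_word_eq[OF word_inv_left[of "{}" u], of "\<lambda>x. x"] act_word_eq[OF word_inv_right[of "{}" u], of "\<lambda>x. x"]
  by (simp_all add: map_prod.id[unfolded id_def] id_def)

lemma act_Bij: "act u \<in> Bij regular_points"
proof -
  have "bij_betw (act u) regular_points regular_points"
    by (rule bij_betw_byWitness[where f' = "act (word_inv u)"])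
      (auto simp: act_regular act_append[symmetric] act_word_inv act_Nil)
  moreover have "act u \<in> extensional regular_points" by (simp add: act_def)
  ultimately show ?thesis by (simp add: Bij_def)
qed

lemma act_mult: "act u \<otimes>\<^bsub>BijGroup regular_points\<^esub> act v = act (u @ v)"
proof
  fix x show "(act u \<otimes>\<^bsub>BijGroup regular_points\<^esub> act v) x = act (u @ v) x"
  proof (cases "x \<in> regular_points")
    case True
    then show ?thesis by (simp add: BijGroup_def act_Bij compose_def act_append)
  next
    case False
    then have "act w x = undefined" for w by (simp add: act_def)
    then show ?thesis using False by (simp add: BijGroup_def act_Bij compose_def)
  qed
qed

lemma act_one: "\<one>\<^bsub>BijGroup regular_points\<^esub> = act []"
  by (auto simp: BijGroup_def act_def restrict_def)

lemma act_carrier: "act u \<in> carrier (BijGroup regular_points)"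
  by (simp add: BijGroup_def act_Bij)

lemma act_inv: "inv\<^bsub>BijGroup regular_points\<^esub> act u = act (word_inv u)"
  by (rule group.inv_equality[OF group_BijGroup]) (simp_all add: act_mult act_one act_word_inv act_carrier)

lemma bij_bt_act: "bij_bt g = act [(g, True)]"
  by (simp add: bij_bt_def act_def map_comp_Some)

text \<open>Stated for a map \<open>f\<close> of letters in order to treat the reflections
  (\<open>f = S\<close>) and all generators (\<open>f\<close> the identity) together.\<close>

lemma generate_act:
  "generate (BijGroup regular_points) (carrier (BijGroup regular_points) \<inter> range (\<lambda>i. bij_bt (f i)))
    = range (\<lambda>w. act (map (map_prod f id) w))" (is "generate ?B ?S = range ?h")
proof (intro equalityI subsetI)
  fix x assume "x \<in> generate ?B ?S"
  then show "x \<in> range ?h"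
  proof induction
    case one
    then show ?case unfolding act_one by (rule range_eqI[of _ _ "[]"]) simp
  next
    case (incl h)
    then obtain i where "h = act [(f i, True)]" by (auto simp: bij_bt_act)
    then show ?case by (intro range_eqI[of _ _ "[(i, True)]"]) simp
  next
    case (inv h)
    then obtain i where "h = act [(f i, True)]" by (auto simp: bij_bt_act)
    then show ?case by (intro range_eqI[of _ _ "[(i, False)]"]) (simp add: act_inv word_inv_def)
  next
    case (eng h1 h2)
    then obtain u v where "h1 = ?h u" "h2 = ?h v" by blast
    then show ?case by (intro range_eqI[of _ _ "u @ v"]) (simp add: act_mult id_def)
  qed
next
  fix x assume "x \<in> range ?h"
  then obtain w where x: "x = ?h w" by blast
  have "?h w \<in> generate ?B ?S"
  proof (induction w)
    case Nil
    then show ?case using generate.one[of ?B ?S] by (simp add: act_one)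
  next
    case (Cons l w)
    obtain i e where l: "l = (i, e)" by force
    have i: "act [(f i, True)] \<in> ?S" by (auto simp: bij_bt_act act_carrier)
    have "act [(f i, e)] \<in> generate ?B ?S"
      using generate.incl[OF i, of ?B] generate.inv[OF i, of ?B] by (cases e) (simp_all add: act_inv word_inv_def)
    from generate.eng[OF this Cons] show ?case by (simp add: act_mult l)
  qed
  then show "x \<in> generate ?B ?S" using x by simp
qed

lemma carrier_subgroup_s: "carrier baecklund_subgroup_s = range (\<lambda>w. act (embed w))"
  using generate_act[of S] by (simp add: baecklund_subgroup_s_def subgroup_generated_def)

lemma carrier_group: "carrier baecklund_group = range act"
  using generate_act[of "\<lambda>x. x"] by (simp add: baecklund_group_def subgroup_generated_def map_prod.id[unfolded id_def] id_def)

lemma group_baecklund: "group baecklund_group"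
  by (simp add: baecklund_group_def group_BijGroup group.group_subgroup_generated)

lemma mult_group: "act u \<otimes>\<^bsub>baecklund_group\<^esub> act v = act (u @ v)"
  by (simp add: baecklund_group_def act_mult)

lemma one_group: "\<one>\<^bsub>baecklund_group\<^esub> = act []"
  by (simp add: baecklund_group_def act_one)

lemma act_in_group: "act u \<in> carrier baecklund_group"
  by (simp add: carrier_group)

lemma inv_group: "inv\<^bsub>baecklund_group\<^esub> act u = act (word_inv u)"
  by (rule group.inv_equality[OF group_baecklund]) (simp_all add: mult_group one_group act_word_inv act_in_group)

text \<open>The braid relation of \<open>s0\<close> and \<open>s1\<close>, with \<open>a\<close>,
  \<open>b\<close> their parameters. In terms of \<open>X = q p + a\<close> and
  \<open>Y = q p - b\<close>, both sides are \<open>q X / Y\<close> in the first identity and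
  \<open>p Y / X\<close> in the second.\<close>

lemma braid_formula:
  fixes q p a b :: complex
  assumes "p \<noteq> 0" "q \<noteq> 0" "q + a / p \<noteq> 0" "p - b / q \<noteq> 0"
  shows "q + a / p + b / (p - (b + a) / (q + a / p)) = q + (a + b) / (p - b / q)"
    and "p - (b + a) / (q + a / p) = p - b / q - a / (q + (a + b) / (p - b / q))"
proof -
  define X Y where "X = q * p + a" and "Y = q * p - b"
  have X: "q + a / p = X / p" and Y: "p - b / q = Y / q"
    using assms by (auto simp: X_def Y_def field_simps)
  have nz: "X \<noteq> 0" "Y \<noteq> 0" using assms unfolding X Y by auto
  have 1: "p - (b + a) / (q + a / p) = p * Y / X"
    unfolding X using nz assms by (simp add: X_def Y_def field_simps)
  have 2: "q + (a + b) / (p - b / q) = q * X / Y"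
    unfolding Y using nz assms by (simp add: X_def Y_def field_simps)
  have 3: "X / p + b / (p * Y / X) = q * X / Y"
    using nz assms by (simp add: field_simps) (simp add: X_def Y_def algebra_simps)
  show "q + a / p + b / (p - (b + a) / (q + a / p)) = q + (a + b) / (p - b / q)"
    unfolding 1 2 unfolding X 3 ..
  show "p - (b + a) / (q + a / p) = p - b / q - a / (q + (a + b) / (p - b / q))"
    unfolding 1 2 unfolding Y using nz assms by (simp add: field_simps) (simp add: X_def Y_def algebra_simps)
qed

lemma braid_formula_shift:
  fixes q p a b :: complex
  assumes "p \<noteq> 0" "q \<noteq> 1" "q + a / p \<noteq> 1" "p \<noteq> b / (q - 1)"
  shows "q + a / p + b / (p - (b + a) / (q + a / p - 1)) = q + (a + b) / (p - b / (q - 1))"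
    and "p - (b + a) / (q + a / p - 1) = p - b / (q - 1) - a / (q + (a + b) / (p - b / (q - 1)) - 1)"
proof -
  have *: "q - 1 + x = q + x - 1" for x by simp
  have "p \<noteq> 0" "q - 1 \<noteq> 0" "q - 1 + a / p \<noteq> 0" "p - b / (q - 1) \<noteq> 0"
    using assms by (auto simp: *)
  note f = braid_formula[OF this]
  show "q + a / p + b / (p - (b + a) / (q + a / p - 1)) = q + (a + b) / (p - b / (q - 1))"
    using f(1) unfolding * by (simp add: algebra_simps)
  show "p - (b + a) / (q + a / p - 1) = p - b / (q - 1) - a / (q + (a + b) / (p - b / (q - 1)) - 1)"
    using f(2) unfolding * .
qed

lemma bt_s_commute:
  assumes "i \<noteq> j" "\<not> adjacent i j"
  shows "bt_s i \<circ>\<^sub>m bt_s j = bt_s j \<circ>\<^sub>m bt_s i"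
proof
  fix x :: point
  obtain q p t a where x: "x = (q, p, t, a)" by (metis prod_cases4)
  show "(bt_s i \<circ>\<^sub>m bt_s j) x = (bt_s j \<circ>\<^sub>m bt_s i) x"
    using assms unfolding x
    by (cases i; cases j)
      (simp_all add: adjacent_def edges_def map_comp_def algebra_simps, (intro impI conjI params_eqI; simp)+)
qed

text \<open>Unlike in the commuting case, the two sides can have different domains:
  \<open>s0 s1 s0\<close> may be defined at \<open>q = 0\<close>, where \<open>s1 s0 s1\<close> is
  not. Agreement where both are defined suffices at regular points.\<close>

lemma bt_s_braid:
  assumes "adjacent i j"
    and "(bt_s i \<circ>\<^sub>m (bt_s j \<circ>\<^sub>m bt_s i)) x = Some y" "(bt_s j \<circ>\<^sub>m (bt_s i \<circ>\<^sub>m bt_s j)) x = Some z"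
  shows "y = z"
proof -
  obtain q p t a where x: "x = (q, p, t, a)" by (metis prod_cases4)
  have *: "y = z" if "(i, j) \<in> edges"
    and "(bt_s i \<circ>\<^sub>m (bt_s j \<circ>\<^sub>m bt_s i)) x = Some y" "(bt_s j \<circ>\<^sub>m (bt_s i \<circ>\<^sub>m bt_s j)) x = Some z" for i j y z
  proof -
    consider "i = N0" "j = N1" | "i = N0" "j = N4" | "(i, j) \<in> {(N1,N2), (N2,N3), (N4,N5), (N5,N6), (N0,N7)}"
      using \<open>(i, j) \<in> edges\<close> unfolding edges_def by auto
    then show ?thesis
    proof cases
      case 1
      then show ?thesis using that(2,3) unfolding 1 x
        by (simp add: map_comp_def split: if_splits)
          (hypsubst, unfold prod.inject, intro conjI HOL.refl params_eqI braid_formula; simp)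
    next
      case 2
      then show ?thesis using that(2,3) unfolding 2 x
        by (simp add: map_comp_def split: if_splits)
          (hypsubst, unfold prod.inject, intro conjI HOL.refl params_eqI braid_formula_shift; simp)
    next
      case 3
      then show ?thesis using that(2,3) unfolding x
        by (elim insertE emptyE Pair_inject) (hypsubst, simp add: map_comp_def split: if_splits,
            hypsubst?, unfold prod.inject, intro conjI HOL.refl params_eqI; simp add: add_divide_distrib)+
    qed
  qed
  show ?thesis using assms * unfolding adjacent_def by blast
qed

section \<open>Time translations and the extended group\<close>

lemma act_affine_relator:
  assumes "r \<in> affine_relators"
  shows "act (embed r) = act []"
proof -
  have sq: "act (x @ [(S i, True), (S i, True)] @ y) = act (x @ y)" for i x y
  proof -
    have "act [(S i, True), (S i, True)] = act [(S i, True), (S i, False)]"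
      by (simp add: act_def pinv_bt_s)
    then have "act [(S i, True), (S i, True)] = act []" using act_cancel[of "S i" True] by simp
    from act_cong[OF this] show ?thesis by simp
  qed
  from assms show ?thesis
    unfolding affine_relators_def
  proof (elim UnE CollectE exE conjE)
    fix i assume "r = [(i, True), (i, True)]"
    then show ?thesis using sq[of "[]" i "[]"] by simp
  next
    fix i j assume r: "r = concat (replicate 3 [(i, True), (j, True)])" and adj: "adjacent i j"
    have "act [(S i, True), (S j, True), (S i, True)] = act [(S j, True), (S i, True), (S j, True)]"
    proof (rule act_eqI)
      fix x assume x: "x \<in> regular_points"
      show "act [(S i, True), (S j, True), (S i, True)] x = act [(S j, True), (S i, True), (S j, True)] x"
        by (rule bt_s_braid[OF adj, of x])
          (use act_regular(2)[OF x, of "[(S i, True), (S j, True), (S i, True)]"]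
             act_regular(2)[OF x, of "[(S j, True), (S i, True), (S j, True)]"] in \<open>simp_all add: map_comp_Some\<close>)
    qed
    \<comment> \<open>The braid relation turns the relator into \<open>j i j j i j\<close>, which
      cancels from the middle outwards.\<close>
    from act_cong[OF this, of "[]" "[(S j, True), (S i, True), (S j, True)]"]
    show ?thesis
      using sq[of "[(S j, True), (S i, True)]" j "[(S i, True), (S j, True)]"] sq[of "[(S j, True)]" i "[(S j, True)]"]
        sq[of "[]" j "[]"] by (simp add: r numeral_eq_Suc)
  next
    fix i j assume r: "r = concat (replicate 2 [(i, True), (j, True)])" and ij: "i \<noteq> j" "\<not> adjacent i j"
    have "act [(S i, True), (S j, True)] = act [(S j, True), (S i, True)]"
      using bt_s_commute[OF ij] by (simp add: act_def map_comp_Some)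
    from act_cong[OF this, of "[]" "[(S i, True), (S j, True)]"]
    show ?thesis
      using sq[of "[(S j, True)]" i "[(S j, True)]"] sq[of "[]" j "[]"] by (simp add: r numeral_eq_Suc)
  qed
qed

lemma bt_pi_eq: "bt_pi (q, p, t, a) = Some (1 - q, - p, t + 1, a \<circ> diagram_aut)"
  by (simp only: bt_pi.simps permute_pi)

lemma act_Pi: "act [(Pi, True), (S i, True), (Pi, False)] = act [(S (diagram_aut i), True)]"
proof -
  have "act [(Pi, True), (S i, True)] = act [(S (diagram_aut i), True), (Pi, True)]"
    using bt_pi_bt_s[of i] by (simp add: act_def map_comp_Some)
  from act_cong[OF this, of "[]" "[(Pi, False)]"]
  show ?thesis using act_cong[OF act_cancel[of Pi True], of "[(S (diagram_aut i), True)]" "[]"] by simp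
qed

text \<open>No generator formula involves \<open>t\<close> except through adding a constant to it;
  this makes time translations central.\<close>

lemma word_bt_time:
  "word_bt u (q, p, t, a) = Some (q', p', t', a') \<Longrightarrow> word_bt u (q, p, t + c, a) = Some (q', p', t' + c, a')"
proof (induction u arbitrary: q' p' t' a' rule: word_bt.induct)
  case (2 g e u)
  then obtain q1 p1 t1 a1 where 1: "word_bt u (q, p, t, a) = Some (q1, p1, t1, a1)"
    "(if e then bt g else pinv (bt g)) (q1, p1, t1, a1) = Some (q', p', t', a')"
    by (auto simp: map_comp_def split: option.splits)
  have "(if e then bt g else pinv (bt g)) (q1, p1, t1 + c, a1) = Some (q', p', t' + c, a')"
  proof (cases g)
    case (S i)
    then show ?thesis using 1(2) by (cases i) (auto simp: pinv_bt_s split: if_splits)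
  next
    case Pi
    then show ?thesis using 1(2) by (auto simp: pinv_bt_pi bt_pi_inv_def split: if_splits)
  qed
  then show ?case using 2(1)[OF 1(1)] by simp
qed simp

section \<open>The action at the zero parameter\<close>

lemma word_bt_zero_params:
  assumes "q \<noteq> 0" "q \<noteq> 1" "p \<noteq> 0"
  shows "\<exists>Q P t'. word_bt u (q, p, t, \<lambda>_. 0) = Some (Q, P, t', \<lambda>_. 0) \<and> Q \<noteq> 0 \<and> Q \<noteq> 1 \<and> P \<noteq> 0"
proof (induction u rule: word_bt.induct)
  case 1
  then show ?case using assms by simp
next
  case (2 g e u)
  then obtain Q P t' where *: "word_bt u (q, p, t, \<lambda>_. 0) = Some (Q, P, t', \<lambda>_. 0)"
    "Q \<noteq> 0" "Q \<noteq> 1" "P \<noteq> 0" by blast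
  show ?case
  proof (cases g)
    case (S i)
    have "bt_s i (Q, P, t', \<lambda>_. 0) = Some (Q, P, t', \<lambda>_. 0)"
      using * by (cases i) (auto intro!: params_eqI)
    then show ?thesis using * by (simp add: S pinv_bt_s)
  next
    case Pi
    have "bt_pi (Q, P, t', \<lambda>_. 0) = Some (1 - Q, - P, t' + 1, \<lambda>_. 0)"
      "bt_pi_inv (Q, P, t', \<lambda>_. 0) = Some (1 - Q, - P, t' - 1, \<lambda>_. 0)"
      by (auto intro!: params_eqI simp: bt_pi_inv_def)
    then show ?thesis using * by (simp add: Pi pinv_bt_pi del: bt_pi.simps)
  qed
qed

lemma word_bt_embed_zero_params:
  assumes "q \<noteq> 0" "q \<noteq> 1" "p \<noteq> 0"
  shows "word_bt (embed u) (q, p, t, \<lambda>_. 0) = Some (q, p, t, \<lambda>_. 0)"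
proof (induction u)
  case (Cons l u)
  obtain i e where l: "l = (i, e)" by force
  have "bt_s i (q, p, t, \<lambda>_. 0) = Some (q, p, t, \<lambda>_. 0)"
    using assms by (cases i) (auto intro!: params_eqI)
  then show ?case using Cons by (simp add: l pinv_bt_s)
qed simp

text \<open>Provides explicit regular points at which the reflections are trivial but
  \<open>Pi\<close> is not, as needed to detect the parity of \<open>Pi\<close> in a word.\<close>

lemma zero_params_regular:
  assumes "q \<noteq> 0" "q \<noteq> 1" "p \<noteq> 0"
  shows "(q, p, t, \<lambda>_. 0) \<in> regular_points"
  using word_bt_zero_params[OF assms] by (fastforce simp: regular_points_def admissible_def)

section \<open>The central subgroup of time translations\<close>

lemma time_translationsI:
  assumes "\<And>q p t a. (q, p, t, a) \<in> regular_points \<Longrightarrow> act u (q, p, t, a) = (q, p, t + c, a)"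
  shows "act u \<in> time_translations"
  using assms by (auto simp: time_translations_def act_in_group)

lemma time_translationsE:
  assumes "g \<in> time_translations"
  obtains u c where "g = act u"
    "\<And>q p t a. (q, p, t, a) \<in> regular_points \<Longrightarrow> act u (q, p, t, a) = (q, p, t + c, a)"
proof -
  obtain c where c: "\<forall>(q, p, t, a) \<in> regular_points. g (q, p, t, a) = (q, p, t + c, a)"
    and g: "g \<in> carrier baecklund_group"
    using assms by (auto simp: time_translations_def)
  then obtain u where u: "g = act u" by (auto simp: carrier_group)
  show thesis by (rule that[OF u, of c]) (use c u in auto)
qed

lemma time_translation_central:
  assumes "\<And>q p t a. (q, p, t, a) \<in> regular_points \<Longrightarrow> act z (q, p, t, a) = (q, p, t + c, a)"
  shows "act (u @ z) = act (z @ u)"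
proof (rule act_eqI)
  fix x assume x: "x \<in> regular_points"
  obtain q p t a where x': "x = (q, p, t, a)" by (metis prod_cases4)
  obtain q' p' t' a' where u: "act u x = (q', p', t', a')" by (metis prod_cases4)
  have zx: "act z x = (q, p, t + c, a)" using assms x x' by simp
  have "word_bt u (q, p, t + c, a) = Some (q', p', t' + c, a')"
    using word_bt_time[of u q p t a q' p' t' a' c] act_regular(2)[OF x, of u] u x' by simp
  then have "act u (act z x) = (q', p', t' + c, a')"
    using act_regular(2)[OF act_regular(1)[OF x, of z], of u] zx by simp
  moreover have "act z (act u x) = (q', p', t' + c, a')"
    using assms act_regular(1)[OF x, of u] u by simp
  ultimately show "act (u @ z) x = act (z @ u) x" using x by (simp add: act_append)
qed

lemma subgroup_time_translations: "subgroup time_translations baecklund_group"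
proof (rule group.subgroupI[OF group_baecklund])
  show "time_translations \<subseteq> carrier baecklund_group" by (auto simp: time_translations_def)
  have "act [] \<in> time_translations" by (rule time_translationsI[of _ 0]) (simp add: act_Nil)
  then show "time_translations \<noteq> {}" by blast
next
  fix g assume "g \<in> time_translations"
  then obtain u c where g: "g = act u"
    and u: "\<And>q p t a. (q, p, t, a) \<in> regular_points \<Longrightarrow> act u (q, p, t, a) = (q, p, t + c, a)"
    by (metis time_translationsE)
  have "act (word_inv u) \<in> time_translations"
  proof (rule time_translationsI[of _ "- c"])
    fix q p t a assume x: "(q, p, t, a) \<in> regular_points"
    obtain q' p' t' a' where y: "act (word_inv u) (q, p, t, a) = (q', p', t', a')" by (metis prod_cases4)
    have "act u (act (word_inv u) (q, p, t, a)) = (q, p, t, a)"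
      using x by (simp add: act_append[symmetric] act_word_inv act_Nil)
    moreover have "act u (act (word_inv u) (q, p, t, a)) = (q', p', t' + c, a')"
      using act_regular(1)[OF x, of "word_inv u"] u y by simp
    ultimately show "act (word_inv u) (q, p, t, a) = (q, p, t + - c, a)" using y by auto
  qed
  then show "inv\<^bsub>baecklund_group\<^esub> g \<in> time_translations" by (simp add: g inv_group)
next
  fix g h assume "g \<in> time_translations" "h \<in> time_translations"
  then obtain u c v d where g: "g = act u" and h: "h = act v"
    and u: "\<And>q p t a. (q, p, t, a) \<in> regular_points \<Longrightarrow> act u (q, p, t, a) = (q, p, t + c, a)"
    and v: "\<And>q p t a. (q, p, t, a) \<in> regular_points \<Longrightarrow> act v (q, p, t, a) = (q, p, t + d, a)"
    by (metis time_translationsE)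
  have "act (u @ v) \<in> time_translations"
  proof (rule time_translationsI[of _ "d + c"])
    fix q p t a assume x: "(q, p, t, a) \<in> regular_points"
    then show "act (u @ v) (q, p, t, a) = (q, p, t + (d + c), a)"
      using act_regular(1)[OF x, of v] by (simp add: act_append u v add.assoc)
  qed
  then show "g \<otimes>\<^bsub>baecklund_group\<^esub> h \<in> time_translations" by (simp add: g h mult_group)
qed

lemma normal_time_translations: "time_translations \<lhd> baecklund_group"
proof (rule group.normalI[OF group_baecklund subgroup_time_translations], rule ballI)
  fix x assume "x \<in> carrier baecklund_group"
  then obtain u where x: "x = act u" by (auto simp: carrier_group)
  have "h \<otimes>\<^bsub>baecklund_group\<^esub> x = x \<otimes>\<^bsub>baecklund_group\<^esub> h" if h: "h \<in> time_translations" for h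
    using h
  proof (rule time_translationsE)
    fix z c assume "h = act z"
      and "\<And>q p t a. (q, p, t, a) \<in> regular_points \<Longrightarrow> act z (q, p, t, a) = (q, p, t + c, a)"
    then show ?thesis using time_translation_central[of z c u] by (simp add: x mult_group)
  qed
  then show "time_translations #>\<^bsub>baecklund_group\<^esub> x = x <#\<^bsub>baecklund_group\<^esub> time_translations"
    by (auto simp: r_coset_def l_coset_def)
qed

text \<open>Forwards the relators hold for the rational maps; backwards the quotient of two words
  with equal action is a word acting trivially, to which \<open>word_bt_faithful\<close>
  applies.\<close>

lemma affine_iff: "aeq u v \<longleftrightarrow> act (embed u) = act (embed v)"
proof
  show "aeq u v \<Longrightarrow> act (embed u) = act (embed v)"
    by (rule act_word_eq[where R = affine_relators]) (use act_affine_relator in auto)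
  assume *: "act (embed u) = act (embed v)"
  have inv: "embed (word_inv v) = word_inv (embed v)"
    by (simp add: word_inv_def rev_map comp_def map_prod_def case_prod_beta)
  have "act (embed (word_inv v @ u)) = act []"
    using act_cong[OF *, of "word_inv (embed v)" "[]"] by (simp add: inv act_word_inv)
  then have "word_bt (embed (word_inv v @ u)) x = Some x" if "x \<in> regular_points" for x
    using act_regular(2)[OF that, of "embed (word_inv v @ u)"] that by (simp add: act_Nil)
  then have "aeq (word_inv v @ u) []" by (intro word_bt_faithful) blast
  then show "aeq u v" by (rule word_eqI)
qed

section \<open>Normal form of words in the extended group\<close>

abbreviation ext_eq :: "gen word \<Rightarrow> gen word \<Rightarrow> bool" where
  "ext_eq \<equiv> word_eq extended_relators"

lemma ext_eq_embed:
  assumes "aeq u v"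
  shows "ext_eq (embed u) (embed v)"
  using assms
proof induction
  case (cancel u g e v)
  show ?case using word_eq.cancel[of extended_relators "embed u" "S g" e "embed v"] by (simp add: id_def)
next
  case (relator r u v)
  then have "embed r \<in> extended_relators" by (auto simp: extended_relators_def)
  from word_eq.relator[OF this, of "embed u" "embed v"] show ?case by (simp add: id_def)
qed (auto intro: word_eq.intros)

lemma ext_eq_Pi_square: "ext_eq [(Pi, True), (Pi, True)] []"
  using word_eq.relator[of "[(Pi, True), (Pi, True)]" extended_relators "[]" "[]"]
  by (simp add: extended_relators_def)

lemma ext_eq_Pi_False: "ext_eq [(Pi, False)] [(Pi, True)]"
proof -
  have "ext_eq [(Pi, False), (Pi, True), (Pi, True)] [(Pi, False)]"
    using word_eq_append[OF ext_eq_Pi_square, of "[(Pi, False)]" "[]"] by simp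
  moreover have "ext_eq [(Pi, False), (Pi, True), (Pi, True)] [(Pi, True)]"
    using word_eq.cancel[of extended_relators "[]" Pi False "[(Pi, True)]"] by simp
  ultimately show ?thesis by (rule word_eq.trans[OF word_eq.sym])
qed

lemma ext_eq_Pi_S: "ext_eq [(Pi, True), (S i, True)] [(S (diagram_aut i), True), (Pi, True)]"
proof -
  let ?u = "[(Pi, True), (S i, True)]" and ?v = "[(Pi, False), (S (diagram_aut i), False)]"
  have "?u @ ?v \<in> extended_relators" by (auto simp: extended_relators_def)
  from word_eq.relator[OF this, of "[]" "word_inv ?v"]
  have "ext_eq (?u @ ?v @ word_inv ?v) (word_inv ?v)" by simp
  moreover have "ext_eq (?u @ ?v @ word_inv ?v) ?u"
    using word_eq_append[OF word_inv_right[of extended_relators ?v], of ?u "[]"] by simp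
  ultimately have "ext_eq ?u (word_inv ?v)" using word_eq.sym word_eq.trans by blast
  then show ?thesis by (simp add: word_inv_def)
qed

lemma ext_eq_S: "ext_eq [(S i, e)] [(S i, True)]"
  using ext_eq_embed[OF aeq_False[of i e]] by simp

lemma ext_eq_Pi_embed: "\<exists>v. ext_eq ((Pi, True) # embed u) (embed v @ [(Pi, True)])"
proof (induction u)
  case Nil
  have "ext_eq ((Pi, True) # embed []) (embed [] @ [(Pi, True)])" by (simp add: word_eq.refl)
  then show ?case by blast
next
  case (Cons l u)
  obtain i e where l: "l = (i, e)" by force
  obtain v where v: "ext_eq ((Pi, True) # embed u) (embed v @ [(Pi, True)])" using Cons by blast
  have "ext_eq ([(Pi, True), (S i, e)] @ embed u) ([(Pi, True), (S i, True)] @ embed u)"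
    using word_eq_append[OF ext_eq_S[of i e], of "[(Pi, True)]" "embed u"] by simp
  moreover have "ext_eq ([(Pi, True), (S i, True)] @ embed u) ([(S (diagram_aut i), True), (Pi, True)] @ embed u)"
    by (intro word_eq_append2 ext_eq_Pi_S word_eq.refl)
  moreover have "ext_eq ([(S (diagram_aut i), True), (Pi, True)] @ embed u) (embed ((diagram_aut i, True) # v) @ [(Pi, True)])"
    using word_eq_append[OF v, of "[(S (diagram_aut i), True)]" "[]"] by simp
  ultimately have "ext_eq ((Pi, True) # embed (l # u)) (embed ((diagram_aut i, True) # v) @ [(Pi, True)])"
    by (simp add: l) (meson word_eq.trans)
  then show ?case by blast
qed

text \<open>\<open>Pi\<close> moves to the right past reflections, relabelling them by the diagram
  automorphism, and cancels in pairs. This leaves an affine word and a parity.\<close>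

lemma ext_eq_normal_form: "\<exists>v. ext_eq u (embed v) \<or> ext_eq u (embed v @ [(Pi, True)])"
proof (induction u)
  case Nil
  have "ext_eq [] (embed [])" by (simp add: word_eq.refl)
  then show ?case by blast
next
  case (Cons l u)
  obtain g e where l: "l = (g, e)" by force
  obtain v y where y: "y = [] \<or> y = [(Pi, True)]" and v: "ext_eq u (embed v @ y)"
    using Cons by (metis append_Nil2)
  show ?case
  proof (cases g)
    case (S i)
    have "ext_eq (l # u) (embed ((i, e) # v) @ y)"
      using word_eq_append[OF v, of "[(S i, e)]" "[]"] by (simp add: l S)
    then show ?thesis using y by (metis append_Nil2)
  next
    case Pi
    have "ext_eq (l # u) ((Pi, True) # u)"
      using word_eq_append[OF ext_eq_Pi_False, of "[]" u] by (cases e) (simp_all add: l Pi word_eq.refl)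
    moreover have "ext_eq ((Pi, True) # u) ((Pi, True) # embed v @ y)"
      using word_eq_append[OF v, of "[(Pi, True)]" "[]"] by simp
    moreover obtain v' where "ext_eq ((Pi, True) # embed v) (embed v' @ [(Pi, True)])"
      using ext_eq_Pi_embed by blast
    then have "ext_eq ((Pi, True) # embed v @ y) (embed v' @ [(Pi, True)] @ y)"
      using word_eq_append[of _ _ _ "[]" y] by fastforce
    ultimately have *: "ext_eq (l # u) (embed v' @ [(Pi, True)] @ y)" by (meson word_eq.trans)
    show ?thesis
    proof (cases "y = []")
      case True
      then have "ext_eq (l # u) (embed v' @ [(Pi, True)])" using * by simp
      then show ?thesis by blast
    next
      case False
      then have "ext_eq (embed v' @ [(Pi, True)] @ y) (embed v')"
        using y word_eq_append[OF ext_eq_Pi_square, of "embed v'" "[]"] by simp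
      then show ?thesis using * word_eq.trans by blast
    qed
  qed
qed

abbreviation coset :: "gen word \<Rightarrow> (point \<Rightarrow> point) set" where
  "coset u \<equiv> time_translations #>\<^bsub>baecklund_group\<^esub> act u"

lemma coset_append: "coset (u @ v) = coset u \<otimes>\<^bsub>baecklund_group Mod time_translations\<^esub> coset v"
  using normal.rcos_sum[OF normal_time_translations, of "act u" "act v"]
  by (simp add: act_in_group mult_group FactGroup_def)

lemma coset_Nil_iff: "coset u = coset [] \<longleftrightarrow> act u \<in> time_translations"
proof -
  have 1: "coset [] = time_translations"
    using group.coset_mult_one[OF group_baecklund] subgroup.subset[OF subgroup_time_translations]
    by (simp add: one_group)
  show ?thesis unfolding 1
    using group.coset_join1[OF group_baecklund _ act_in_group subgroup_time_translations]
      group.coset_join2[OF group_baecklund act_in_group subgroup_time_translations]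
      subgroup.subset[OF subgroup_time_translations] by blast
qed

lemma coset_relator:
  assumes "r \<in> extended_relators"
  shows "coset r = coset []"
  using assms unfolding extended_relators_def
proof (elim UnE CollectE exE conjE imageE singletonE)
  fix r' assume "r = embed r'" "r' \<in> affine_relators"
  then show ?thesis using act_affine_relator by simp
next
  assume r: "r = [(Pi, True), (Pi, True)]"
  show ?thesis unfolding coset_Nil_iff
  proof (rule time_translationsI[of _ 2])
    fix q p t a assume x: "(q, p, t, a) \<in> regular_points"
    have "word_bt r (q, p, t, a) = Some (q, p, t + 2, a)"
      by (simp add: r bt_pi_eq comp_assoc comp_def del: bt_pi.simps)
    then show "act r (q, p, t, a) = (q, p, t + 2, a)" using act_regular(2)[OF x, of r] by simp
  qed
next
  fix i assume r: "r = [(Pi, True), (S i, True), (Pi, False), (S (diagram_aut i), False)]"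
  have "act r = act ([(S (diagram_aut i), True)] @ [(S (diagram_aut i), False)])"
    using act_cong[OF act_Pi[of i], of "[]" "[(S (diagram_aut i), False)]"] by (simp add: r)
  then show ?thesis using act_cancel[of "S (diagram_aut i)" True] by simp
qed

lemma coset_ext_eq: "ext_eq u v \<Longrightarrow> coset u = coset v"
proof (induction rule: word_eq.induct)
  case (cancel u g e v)
  show ?case using act_cong[OF act_cancel] by fastforce
next
  case (relator r u v)
  have "coset (u @ r @ v) = coset (u @ [] @ v)"
    unfolding coset_append coset_relator[OF relator] ..
  then show ?case by simp
qed auto

text \<open>Only the kernel needs work: a word acting as a time translation is put in normal form,
  its parity is shown to be even, and the remaining affine word is trivial by faithfulness.\<close>

lemma coset_iff: "ext_eq u v \<longleftrightarrow> coset u = coset v"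
proof
  show "ext_eq u v \<Longrightarrow> coset u = coset v" by (rule coset_ext_eq)
  assume *: "coset u = coset v"
  define w where "w = word_inv v @ u"
  have "coset w = coset []"
    using coset_append[of "word_inv v" u] coset_append[of "word_inv v" v] * by (simp add: w_def act_word_inv)
  obtain w' y where y: "y = [] \<or> y = [(Pi, True)]" and w': "ext_eq w (embed w' @ y)"
    using ext_eq_normal_form[of w] by (metis append_Nil2)
  have "act (embed w' @ y) \<in> time_translations"
    unfolding coset_Nil_iff[symmetric] using coset_ext_eq[OF w'] \<open>coset w = coset []\<close> by simp
  then obtain c where c: "\<And>q p t a. (q, p, t, a) \<in> regular_points \<Longrightarrow>
      act (embed w' @ y) (q, p, t, a) = (q, p, t + c, a)"
    unfolding time_translations_def by blast
  \<comment> \<open>At zero parameters the affine word fixes \<open>q\<close>, whereas a trailing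
    \<open>Pi\<close> turns \<open>q = 2\<close> into \<open>- 1\<close>, which no time translation
    does.\<close>
  have y: "y = []"
  proof (rule ccontr)
    assume "y \<noteq> []"
    with y have y: "y = [(Pi, True)]" by simp
    have reg: "(2, 1, 0, \<lambda>_. 0) \<in> regular_points" by (rule zero_params_regular) auto
    have "bt_pi (2, 1, 0, \<lambda>_. 0) = Some (- 1, - 1, 1, \<lambda>_. 0)"
      by (auto intro!: params_eqI)
    moreover have "word_bt (embed w') (- 1, - 1, 1, \<lambda>_. 0) = Some (- 1, - 1, 1, \<lambda>_. 0)"
      by (rule word_bt_embed_zero_params) auto
    ultimately have "word_bt (embed w' @ y) (2, 1, 0, \<lambda>_. 0) = Some (- 1, - 1, 1, \<lambda>_. 0)"
      by (simp add: y word_bt_append map_comp_Some del: bt_pi.simps)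
    then show False using c[OF reg] act_regular(2)[OF reg, of "embed w' @ y"] by simp
  qed
  \<comment> \<open>The free time coordinate in \<open>word_bt_faithful\<close> absorbs the shift by
    \<open>c\<close>.\<close>
  have "aeq w' []"
  proof (rule word_bt_faithful)
    fix q p t a assume x: "(q, p, t, a) \<in> regular_points"
    then show "\<exists>d. word_bt (embed w') (q, p, t, a) = Some (q, p, d, a)"
      using act_regular(2)[OF x, of "embed w'"] c[OF x] y by simp
  qed
  then have "ext_eq (embed w') []" using ext_eq_embed by fastforce
  then have "ext_eq w []" using w' y word_eq.trans by fastforce
  then show "ext_eq u v" unfolding w_def by (rule word_eqI)
qed

theorem theorem8p1:
  shows
    "(\<forall>i. baecklund (bt_s i)) \<and> baecklund bt_pi \<and> (\<forall>u. baecklund (word_bt u)) \<and>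
     (\<forall>g. bij_bt g \<in> carrier (BijGroup regular_points)) \<and>
     (\<exists>\<phi> \<in> iso affine_weyl_E7 baecklund_subgroup_s.
        \<forall>i. \<phi> (word_class affine_relators [(i, True)]) = bij_bt (S i)) \<and>
     (\<forall>i j. adjacent (diagram_aut i) (diagram_aut j) \<longleftrightarrow> adjacent i j) \<and>
     (\<forall>i. bij_bt Pi \<otimes>\<^bsub>baecklund_group\<^esub> bij_bt (S i) \<otimes>\<^bsub>baecklund_group\<^esub> inv\<^bsub>baecklund_group\<^esub> bij_bt Pi
          = bij_bt (S (diagram_aut i))) \<and>
     time_translations \<lhd> baecklund_group \<and>
     (\<exists>\<phi> \<in> iso extended_affine_weyl_E7 (baecklund_group Mod time_translations).
        \<forall>g. \<phi> (word_class extended_relators [(g, True)])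
            = time_translations #>\<^bsub>baecklund_group\<^esub> bij_bt g)"
proof (intro conjI allI)
  show "baecklund (bt_s i)" for i by (rule baecklund_s)
  show "baecklund bt_pi" by (rule baecklund_pi)
  show "baecklund (word_bt u)" for u by (rule baecklund_word)
  show "bij_bt g \<in> carrier (BijGroup regular_points)" for g by (simp add: bij_bt_act act_carrier)
  have "\<exists>\<phi> \<in> iso (presented_group affine_relators) baecklund_subgroup_s.
      \<forall>u. \<phi> (word_class affine_relators u) = act (embed u)"
    by (rule presented_group_iso[OF carrier_subgroup_s[symmetric] _ affine_iff])
      (simp add: baecklund_subgroup_s_def act_mult)
  then show "\<exists>\<phi> \<in> iso affine_weyl_E7 baecklund_subgroup_s.
        \<forall>i. \<phi> (word_class affine_relators [(i, True)]) = bij_bt (S i)"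
    unfolding affine_weyl_E7_def by (elim bexE, intro bexI) (simp_all add: bij_bt_act)
  show "adjacent (diagram_aut i) (diagram_aut j) \<longleftrightarrow> adjacent i j" for i j
    by (cases i; cases j) (auto simp: adjacent_def edges_def)
  show "bij_bt Pi \<otimes>\<^bsub>baecklund_group\<^esub> bij_bt (S i) \<otimes>\<^bsub>baecklund_group\<^esub> inv\<^bsub>baecklund_group\<^esub> bij_bt Pi
          = bij_bt (S (diagram_aut i))" for i
    by (simp add: bij_bt_act mult_group inv_group word_inv_def act_Pi)
  show "time_translations \<lhd> baecklund_group" by (rule normal_time_translations)
  have "\<exists>\<phi> \<in> iso (presented_group extended_relators) (baecklund_group Mod time_translations).
      \<forall>u. \<phi> (word_class extended_relators u) = coset u"
    by (rule presented_group_iso)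
      (auto simp: coset_append coset_iff FactGroup_def RCOSETS_def carrier_group)
  then show "\<exists>\<phi> \<in> iso extended_affine_weyl_E7 (baecklund_group Mod time_translations).
        \<forall>g. \<phi> (word_class extended_relators [(g, True)])
            = time_translations #>\<^bsub>baecklund_group\<^esub> bij_bt g"
    by (auto simp: extended_affine_weyl_E7_def bij_bt_act)
qed

end
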